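(* Consider the Stochastic Online Sorting Problem with $n$ inputs drawn i.i.d. from $\mathcal{U}(0,1)$ and the phased algorithm described in the context. There is an absolute constant $D$ such that, for all sufficiently large $n$, with probability at least $1-1/n$ the algorithm incurs total cost at most $D\log^{2} n$.
   Context: Online Sorting: an array $A[1..n]$ of initially empty cells is given; real numbers $x_1,\dots,x_n\in[0,1]$ arrive one at a time and each must be placed immediately and irrevocably into an empty cell; the cost is $\sum_{i=1}^{n-1}|A[i+1]-A[i]|$. In the stochastic version the $x_t$ are i.i.d. $\mathcal{U}(0,1)$. Logarithms are base 2. Let $\mathcal{A}_{adv}$ denote the deterministic adversarial online sorting algorithm of Aamand, Abrahamsen, Beretta and Kleist, which places $m$ numbers from an interval of length $L$ online into $m$ cells with cost $O(\sqrt{m}\,L)$; "placing into a bucket using $\mathcal{A}_{adv}$" means running it on the cells of that bucket. The algorithm. Let $\ell$ be the unique positive integer with $\frac{n}{4\log^2 n} < 2^\ell \le \frac{n}{2\log^2 n}$. The array is divided into consecutive contiguous subarrays $A_1, A_2, \dots$ with $|A_i| = \lfloor n/2^i\rfloor$ (we write $A_i$ also for its length), followed by a final subarray $B$; subarrays are allocated while the number of not-yet-allocated cells is at least $100\log^2 n$, and the last allocated one is $A_k$ ($k\le \ell$); $B$ consists of the remaining fewer than $100\log^2 n$ cells at the end. Put $K_i = 2^{\ell-i+1}$. Subarray $A_i$ is divided into $K_i$ contiguous buckets, bucket $j\in[K_i]$ receiving numbers in $(\frac{j-1}{K_i},\frac{j}{K_i}]$ (the number $0$ goes to bucket 1); inside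 each bucket numbers are placed with $\mathcal{A}_{adv}$. Phase 1: $A_1$'s buckets have sizes $\lfloor C_1\rfloor$ or $\lfloor C_1\rfloor+1$ summing to $A_1$, where $C_1 = A_1/K_1$. Each arriving number goes to its bucket in $A_1$; when it arrives and its bucket is full (an overflow), Phase 2 starts. Phase $i\ge 2$: let $N_{i-1}$ be the number of elements placed in $A_{i-1}$ up to the first overflow in $A_{i-1}$, and $C_i = (A_{i-1}+A_i-N_{i-1})/K_i$. Bin $j\in[K_i]$ consists of the empty cells of buckets $2j-1,2j$ of $A_{i-1}$ together with bucket $j$ of $A_i$ (all serving $(\frac{j-1}{K_i},\frac{j}{K_i}]$). Bin capacities are chosen in $\{\lfloor C_i\rfloor,\lfloor C_i\rfloor+1\}$ summing to $A_{i-1}+A_i-N_{i-1}$, and the size of bucket $j$ of $A_i$ is the capacity of bin $j$ minus the number of empty cells in buckets $2j-1,2j$ of $A_{i-1}$ at that moment. An arriving number is placed in its designated bucket of $A_{i-1}$ if that bucket has an empty cell, otherwise in its designated bucket of $A_i$; when its designated bucket in $A_i$ is also full, an overflow of $A_i$ occurs and Phase $i+1$ starts. Final phase: when $A_k$ overflows, all remaining numbers are placed in $B$ using $\mathcal{A}_{adv}$. *)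

theory Defs
  imports "HOL-Probability.Probability"
begin

definition array_cost :: "nat \<Rightarrow> (nat \<Rightarrow> real) \<Rightarrow> real" where
  "array_cost n A = (\<Sum>i<n - 1. \<bar>A (Suc i) - A i\<bar>)"

text \<open>
  A deterministic online placement rule \<open>adv\<close>: \<open>adv m a b (x\<^sub>1, \<dots>, x\<^sub>t)\<close> is the cell, among the cells
  \<open>0, \<dots>, m - 1\<close>, into which \<open>x\<^sub>t\<close> is put when \<open>m\<close> numbers from \<open>[a, b]\<close> are to be sorted and
  \<open>x\<^sub>1, \<dots>, x\<^sub>t\<close> have been revealed. Since every sequence of fewer than \<open>m\<close> numbers extends to one of
  length \<open>m\<close>, bijectivity for full sequences says that each number is put into an empty cell.
\<close>

type_synonym placement_rule = "nat \<Rightarrow> real \<Rightarrow> real \<Rightarrow> real list \<Rightarrow> nat"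

definition online_sorting_algorithm :: "placement_rule \<Rightarrow> bool" where
  "online_sorting_algorithm adv \<longleftrightarrow>
    (\<forall>m a b xs. a < b \<longrightarrow> length xs = m \<longrightarrow> set xs \<subseteq> {a..b} \<longrightarrow>
      bij_betw (\<lambda>t. adv m a b (take (Suc t) xs)) {..<m} {..<m})"

definition adversarial_cost_sqrt :: "placement_rule \<Rightarrow> bool" where
  "adversarial_cost_sqrt adv \<longleftrightarrow>
    (\<exists>c. \<forall>m a b xs A. a < b \<longrightarrow> length xs = m \<longrightarrow> set xs \<subseteq> {a..b} \<longrightarrow>
      (\<forall>t<m. A (adv m a b (take (Suc t) xs)) = xs ! t) \<longrightarrow>
      array_cost m A \<le> c * sqrt (real m) * (b - a))"

definition ell :: "nat \<Rightarrow> nat" where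
  "ell n = (THE l. l > 0 \<and> real n / (4 * (log 2 (real n))\<^sup>2) < 2 ^ l
                        \<and> 2 ^ l \<le> real n / (2 * (log 2 (real n))\<^sup>2))"

definition sub_len :: "nat \<Rightarrow> nat \<Rightarrow> nat" where
  "sub_len n i = n div 2 ^ i"

definition num_subs :: "nat \<Rightarrow> nat" where
  "num_subs n = (LEAST k. real (n - (\<Sum>i=1..k. sub_len n i)) < 100 * (log 2 (real n))\<^sup>2)"

definition B_len :: "nat \<Rightarrow> nat" where
  "B_len n = n - (\<Sum>i=1..num_subs n. sub_len n i)"

definition num_buckets :: "nat \<Rightarrow> nat \<Rightarrow> nat" where
  "num_buckets n i = 2 ^ (ell n + 1 - i)"

definition bucket :: "nat \<Rightarrow> real \<Rightarrow> nat" where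
  "bucket K x = (if x = 0 then 1 else nat \<lceil>real K * x\<rceil>)"

lemma bucket_iff:
  assumes "K > 0" "0 < x" "x \<le> 1"
  shows "bucket K x = j \<longleftrightarrow>
    j \<in> {1..K} \<and> x \<in> {(real j - 1) / real K <.. real j / real K}"
proof -
  have pos: "real K * x > 0" and le: "real K * x \<le> real K"
    using assms by (auto simp: mult_le_cancel_left1)
  have "\<lceil>real K * x\<rceil> \<ge> 1" "\<lceil>real K * x\<rceil> \<le> int K"
    using pos le by (simp_all add: one_le_ceiling ceiling_le_iff)
  then have "bucket K x = j \<longleftrightarrow> j \<in> {1..K} \<and> \<lceil>real K * x\<rceil> = int j"
    using assms(2) unfolding bucket_def atLeastAtMost_iff
    by (cases "x = 0"; simp only: if_False; arith)
  also have "\<lceil>real K * x\<rceil> = int j \<longleftrightarrow> x \<in> {(real j - 1) / real K <.. real j / real K}"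
    using assms(1) by (auto simp: ceiling_eq_iff field_simps)
  finally show ?thesis .
qed

text \<open>
  \<open>split h T K j\<close> is the capacity of part \<open>j \<in> {1..K}\<close> when \<open>T\<close> cells are shared among \<open>K\<close> parts after
  the numbers \<open>h\<close> have arrived; which parts are rounded up is left open.
\<close>

definition balanced_split :: "(real list \<Rightarrow> nat \<Rightarrow> nat \<Rightarrow> nat \<Rightarrow> nat) \<Rightarrow> bool" where
  "balanced_split split \<longleftrightarrow>
    (\<forall>h T K. K > 0 \<longrightarrow>
      (\<forall>j\<in>{1..K}. int (split h T K j) \<in> {\<lfloor>real T / real K\<rfloor>, \<lfloor>real T / real K\<rfloor> + 1}) \<and>
      (\<Sum>j=1..K. split h T K j) = T)"

text \<open>
  \<open>spill h E\<close> selects one of the empty cells \<open>E\<close>, arbitrarily, for the last number of \<open>h\<close>. It is used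
  only where the phases prescribe no cell: in the final phase once \<open>B\<close> is full (cells of \<open>A\<^sub>k\<close> may
  still be empty then), and after a bucket size would have become negative.
\<close>

definition chooses_member :: "(real list \<Rightarrow> nat set \<Rightarrow> nat) \<Rightarrow> bool" where
  "chooses_member spill \<longleftrightarrow> (\<forall>h E. finite E \<longrightarrow> E \<noteq> {} \<longrightarrow> spill h E \<in> E)"

datatype mode = Phase nat | Final | Stuck

text \<open>
  \<open>items s i j\<close> and \<open>bucket_size s i j\<close> refer to bucket \<open>j\<close> of \<open>A\<^sub>i\<close>, \<open>B_items\<close> to \<open>B\<close>; items are listed
  in order of arrival. \<open>seen\<close> lists all arrivals. Cells of the array are \<open>0, \<dots>, n - 1\<close>.
\<close>

record state =
  mode :: mode
  bucket_size :: "nat \<Rightarrow> nat \<Rightarrow> nat"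
  items :: "nat \<Rightarrow> nat \<Rightarrow> real list"
  B_items :: "real list"
  seen :: "real list"
  arr :: "nat \<Rightarrow> real option"

definition free_cells :: "state \<Rightarrow> nat \<Rightarrow> nat \<Rightarrow> nat" where
  "free_cells s i j = bucket_size s i j - length (items s i j)"

locale phased_sorting =
  fixes n :: nat
    and adv :: placement_rule
    and split :: "real list \<Rightarrow> nat \<Rightarrow> nat \<Rightarrow> nat \<Rightarrow> nat"
    and spill :: "real list \<Rightarrow> nat set \<Rightarrow> nat"
begin

definition init :: state where
  "init = \<lparr> mode = Phase 1,
            bucket_size = (\<lambda>_ _. 0)(1 := split [] (sub_len n 1) (num_buckets n 1)),
            items = (\<lambda>_ _. []),
            B_items = [],
            seen = [],
            arr = (\<lambda>_. None) \<rparr>"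

definition put_bucket :: "nat \<Rightarrow> nat \<Rightarrow> real \<Rightarrow> state \<Rightarrow> state" where
  "put_bucket i j x s =
    (let K = real (num_buckets n i);
         ys = items s i j @ [x];
         start = (\<Sum>i'=1..<i. sub_len n i') + (\<Sum>j'=1..<j. bucket_size s i j');
         p = start + adv (bucket_size s i j) ((real j - 1) / K) (real j / K) ys
     in s\<lparr> items := (items s)(i := (items s i)(j := ys)), arr := (arr s)(p \<mapsto> x) \<rparr>)"

definition put_B :: "real \<Rightarrow> state \<Rightarrow> state" where
  "put_B x s =
    (let ys = B_items s @ [x];
         p = (\<Sum>i=1..num_subs n. sub_len n i) + adv (B_len n) 0 1 ys
     in s\<lparr> B_items := ys, arr := (arr s)(p \<mapsto> x) \<rparr>)"

definition put_spill :: "real \<Rightarrow> state \<Rightarrow> state" where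
  "put_spill x s = s\<lparr> arr := (arr s)(spill (seen s) {p. p < n \<and> arr s p = None} \<mapsto> x) \<rparr>"

definition start_phase :: "nat \<Rightarrow> state \<Rightarrow> state" where
  "start_phase i s =
    (let N = (\<Sum>j=1..num_buckets n (i - 1). length (items s (i - 1) j));
         cap = split (seen s) (sub_len n (i - 1) + sub_len n i - N) (num_buckets n i);
         free = (\<lambda>j. free_cells s (i - 1) (2 * j - 1) + free_cells s (i - 1) (2 * j))
     in if \<forall>j\<in>{1..num_buckets n i}. free j \<le> cap j
        then s\<lparr> mode := Phase i, bucket_size := (bucket_size s)(i := \<lambda>j. cap j - free j) \<rparr>
        else s\<lparr> mode := Stuck \<rparr>)"

definition next_phase :: "nat \<Rightarrow> state \<Rightarrow> state" where
  "next_phase i s = (if i < num_subs n then start_phase (Suc i) s else s\<lparr> mode := Final \<rparr>)"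

function place :: "real \<Rightarrow> state \<Rightarrow> state" where
  "place x s =
    (case mode s of
       Phase i \<Rightarrow>
         (let j' = bucket (num_buckets n (i - 1)) x; j = bucket (num_buckets n i) x
          in if i \<ge> 2 \<and> free_cells s (i - 1) j' > 0 then put_bucket (i - 1) j' x s
             else if free_cells s i j > 0 then put_bucket i j x s
             else place x (next_phase i s))
     | Final \<Rightarrow> if length (B_items s) < B_len n then put_B x s else put_spill x s
     | Stuck \<Rightarrow> put_spill x s)"
  by pat_completeness auto
termination
  by (relation "Wellfounded.measure (\<lambda>(x, s). case mode s of Phase i \<Rightarrow> Suc (num_subs n - i) | _ \<Rightarrow> 0)")
     (auto simp: next_phase_def start_phase_def Let_def)

declare place.simps [simp del]

definition step :: "state \<Rightarrow> real \<Rightarrow> state" where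
  "step s x = place x (s\<lparr> seen := seen s @ [x] \<rparr>)"

definition total_cost :: "real list \<Rightarrow> real" where
  "total_cost xs = array_cost n (\<lambda>p. the (arr (foldl step init xs) p))"

end

definition iid_uniform :: "nat \<Rightarrow> (nat \<Rightarrow> real) measure" where
  "iid_uniform n = (\<Pi>\<^sub>M t\<in>{..<n}. uniform_measure lborel {0..1})"

end

theory Submission
  imports Defs "HOL-Real_Asymp.Real_Asymp"
begin

text \<open>
  Put \<open>L = log\<^sub>2 n\<close> and \<open>V = L\<^sup>2\<close>; all buckets have between \<open>V / 2\<close> and \<open>3 V\<close> cells.
  By a Chernoff bound, with probability at least \<open>1 - 1 / n\<close> every window of arrivals whose
  expected number of hits in a bucket is at most \<open>3 V\<close> meets that expectation up to \<open>V / 20\<close>,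
  simultaneously for all buckets of all levels. On this event a bin can only overflow when all bins
  of its level are almost full. So whenever \<open>A\<^sub>i\<close> overflows, \<open>A\<^sub>i\<^sub>-\<^sub>1\<close> is full and every bucket
  of \<open>A\<^sub>i\<close> has at most \<open>3 V / 20\<close> empty cells; this bound does not accumulate over the phases.
  In the end each of the at most \<open>L\<close> subarrays contributes \<open>O(\<surd>V) = O(L)\<close>, because its \<open>K\<close>
  buckets cost \<open>O(\<surd>V / K)\<close> each. The last subarray has at most 100 buckets, so the numbers
  spilled into it cost \<open>O(V)\<close> more.
\<close>

section \<open>Concentration of window counts\<close>

text \<open>Phase starts are random times determined by the earlier numbers, so a Chernoff bound
  does not apply to them directly. A union bound over all windows with fixed endpoints removes the
  dependence: on the good event any start time is covered, and the rest of the argument is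
  deterministic, for every choice of \<open>split\<close> and \<open>spill\<close>. The price is a
  polynomial number of windows, against a failure probability that is superpolynomially small in
  \<open>n\<close>. Empty cells do not accumulate because the capacity of a bin already includes the
  cells inherited from the previous subarray. At an overflow one bin has reached its capacity, and
  any other bin lags behind it by at most two deviations \<open>V / 20\<close> and a rounding error
  2, hence by at most \<open>3 * V / 20\<close>. This comparison presupposes that the inherited
  cells are used up, which takes a first, cruder application of concentration at the finer
  level.\<close>

lemma exp_quadratic_upper:
  fixes x :: real
  assumes "\<bar>x\<bar> \<le> 1"
  shows "exp x \<le> 1 + x + x\<^sup>2"
proof (cases "x \<ge> 0")
  case True
  then show ?thesis using assms by (intro exp_bound) auto
next
  case False
  define y where "y = - x"
  have y: "0 \<le> y" "y \<le> 1" using False assms by (auto simp: y_def)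
  \<comment> \<open>Since \<open>(1 - y + y^2) * (1 + y) = 1 + y^3 >= 1\<close>, the polynomial
    dominates \<open>1 / (1 + y)\<close> and hence \<open>exp (- y)\<close>.\<close>
  have "1 + y \<le> exp y" by (rule exp_ge_add_one_self)
  then have "(1 - y + y\<^sup>2) * (1 + y) \<le> (1 - y + y\<^sup>2) * exp y"
    using y by (intro mult_left_mono) (auto simp: power2_eq_square)
  moreover have "(1 - y + y\<^sup>2) * (1 + y) = 1 + y ^ 3"
    by (simp add: algebra_simps power2_eq_square power3_eq_cube)
  ultimately have "1 \<le> (1 - y + y\<^sup>2) * exp y"
    using y by (smt (verit) zero_le_power)
  then have "exp (- y) \<le> 1 - y + y\<^sup>2"
    by (simp add: exp_minus field_simps)
  then show ?thesis by (simp add: y_def)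
qed

context prob_space
begin

lemma integral_exp_indicator:
  assumes "S \<in> events"
  shows "(\<integral>x. exp (\<theta> * indicator S x) \<partial>M) = 1 + prob S * (exp \<theta> - 1)"
    and "integrable M (\<lambda>x. exp (\<theta> * indicator S x) :: real)"
proof -
  have eq: "exp (\<theta> * indicator S x) = 1 + (exp \<theta> - 1) * (indicator S x :: real)" for x
    by (auto simp: indicator_def)
  have int: "integrable M (indicator S :: _ \<Rightarrow> real)"
    using assms by (simp add: emeasure_eq_measure)
  then show "integrable M (\<lambda>x. exp (\<theta> * indicator S x) :: real)"
    unfolding eq by simp
  show "(\<integral>x. exp (\<theta> * indicator S x) \<partial>M) = 1 + prob S * (exp \<theta> - 1)"
    unfolding eq using assms int by (simp add: prob_space mult.commute)
qed

lemma iid_mgf_card: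
  fixes \<theta> :: real
  assumes J: "finite J" "I \<subseteq> J" and S: "S \<in> events"
  defines "X \<equiv> \<lambda>x. real (card {r \<in> I. x r \<in> S})"
  shows "integrable (\<Pi>\<^sub>M r\<in>J. M) (\<lambda>x. exp (\<theta> * X x))"
    and "(\<integral>x. exp (\<theta> * X x) \<partial>(\<Pi>\<^sub>M r\<in>J. M)) = (1 + prob S * (exp \<theta> - 1)) ^ card I"
proof -
  interpret P: product_sigma_finite "\<lambda>_ :: 'b. M"
    by unfold_locales
  \<comment> \<open>Coordinates outside the window contribute the factor 1, so the integral
    factorises over all of \<open>J\<close> without passing to the marginal on
    \<open>I\<close>.\<close>
  define f where "f = (\<lambda>r x. if r \<in> I then exp (\<theta> * indicator S x) else (1 :: real))"
  have I: "finite I" using J finite_subset by blast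
  have eq: "exp (\<theta> * X x) = (\<Prod>r\<in>J. f r (x r))" for x
  proof -
    have "(\<Prod>r\<in>J. f r (x r)) = (\<Prod>r\<in>I. exp (\<theta> * indicator S (x r)))"
      unfolding f_def using J by (simp add: prod.If_cases Int_absorb1)
    also have "\<dots> = exp (\<theta> * (\<Sum>r\<in>I. indicator S (x r)))"
      using I by (simp only: exp_sum sum_distrib_left)
    also have "(\<Sum>r\<in>I. indicator S (x r)) = X x"
      unfolding X_def using I by (simp add: indicator_def sum.If_cases Int_def)
    finally show ?thesis by simp
  qed
  have int: "integrable M (f r)" for r
    unfolding f_def using integral_exp_indicator(2)[OF S] by (cases "r \<in> I") auto
  show "integrable (\<Pi>\<^sub>M r\<in>J. M) (\<lambda>x. exp (\<theta> * X x))"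
    unfolding eq by (intro P.product_integrable_prod J int)
  have "(\<integral>x. exp (\<theta> * X x) \<partial>(\<Pi>\<^sub>M r\<in>J. M)) = (\<Prod>r\<in>J. \<integral>x. f r x \<partial>M)"
    unfolding eq by (intro P.product_integral_prod J int)
  also have "\<dots> = (\<Prod>r\<in>J. if r \<in> I then 1 + prob S * (exp \<theta> - 1) else 1)"
    by (intro prod.cong) (auto simp: f_def integral_exp_indicator(1)[OF S] prob_space)
  also have "\<dots> = (1 + prob S * (exp \<theta> - 1)) ^ card I"
    using J by (simp add: prod.If_cases Int_absorb1)
  finally show "(\<integral>x. exp (\<theta> * X x) \<partial>(\<Pi>\<^sub>M r\<in>J. M)) = (1 + prob S * (exp \<theta> - 1)) ^ card I" .
qed

lemma iid_card_measurable:
  assumes J: "finite J" "I \<subseteq> J" and S: "S \<in> events"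
  shows "(\<lambda>x. real (card {r \<in> I. x r \<in> S})) \<in> borel_measurable (\<Pi>\<^sub>M r\<in>J. M)"
proof -
  have I: "finite I" using J finite_subset by blast
  have eq: "real (card {r \<in> I. x r \<in> S}) = (\<Sum>r\<in>I. indicator S (x r))" for x
    using I by (simp add: indicator_def sum.If_cases Int_def)
  show ?thesis
    unfolding eq
  proof (intro borel_measurable_sum)
    fix r assume "r \<in> I"
    then have "(\<lambda>x. x r) \<in> (\<Pi>\<^sub>M r\<in>J. M) \<rightarrow>\<^sub>M M" using J by auto
    then show "(\<lambda>x. indicator S (x r) :: real) \<in> borel_measurable (\<Pi>\<^sub>M r\<in>J. M)"
      using S by (intro borel_measurable_indicator') (auto intro: measurable_sets)
  qed
qed

text \<open>Markov's inequality for \<open>exp (\<eta> * X)\<close>, with the quadratic bound on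
  \<open>exp\<close> in the moment generating function. The parameter \<open>\<theta>\<close> stays
  free, to be tuned to an upper bound on the mean.\<close>

lemma iid_card_deviation:
  fixes \<theta> d :: real
  assumes J: "finite J" "I \<subseteq> J" and S: "S \<in> events" and \<theta>: "0 < \<theta>" "\<theta> \<le> 1"
  shows "measure (\<Pi>\<^sub>M r\<in>J. M)
           {x \<in> space (\<Pi>\<^sub>M r\<in>J. M). \<bar>real (card {r \<in> I. x r \<in> S}) - prob S * card I\<bar> > d}
         \<le> 2 * exp (\<theta>\<^sup>2 * (prob S * card I) - \<theta> * d)"
proof -
  define X where "X = (\<lambda>x. real (card {r \<in> I. x r \<in> S}))"
  define P where "P = (\<Pi>\<^sub>M r\<in>J. M)"
  define \<mu> where "\<mu> = prob S * card I"
  interpret Q: prob_space P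
    unfolding P_def by (intro prob_space_PiM) (rule prob_space_axioms)
  have X[measurable]: "X \<in> borel_measurable P"
    unfolding X_def P_def by (rule iid_card_measurable[OF J S])
  \<comment> \<open>The sign \<open>s\<close> selects the tail; \<open>\<eta> = \<theta> * s\<close>
    may be negative, so the quadratic bound on \<open>exp\<close> is used on both sides of
    0.\<close>
  have one_sided: "measure P {x \<in> space P. s * (X x - \<mu>) > d} \<le> exp (\<theta>\<^sup>2 * \<mu> - \<theta> * d)"
    if s: "s = 1 \<or> s = -1" for s :: real
  proof -
    define \<eta> where "\<eta> = \<theta> * s"
    have \<eta>: "\<bar>\<eta>\<bar> \<le> 1" "\<eta>\<^sup>2 = \<theta>\<^sup>2" using s \<theta> by (auto simp: \<eta>_def)
    have int: "integrable P (\<lambda>x. exp (\<eta> * X x))"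
      unfolding P_def X_def by (rule iid_mgf_card(1)[OF J S])
    have "measure P {x \<in> space P. s * (X x - \<mu>) > d}
        \<le> measure P {x \<in> space P. exp (\<eta> * X x) \<ge> exp (\<theta> * d + \<eta> * \<mu>)}"
    proof (intro Q.finite_measure_mono subsetI)
      fix x assume "x \<in> {x \<in> space P. s * (X x - \<mu>) > d}"
      moreover from this have "\<theta> * d \<le> \<theta> * (s * (X x - \<mu>))"
        using \<theta> by (intro mult_left_mono) auto
      ultimately show "x \<in> {x \<in> space P. exp (\<eta> * X x) \<ge> exp (\<theta> * d + \<eta> * \<mu>)}"
        by (simp add: \<eta>_def algebra_simps)
    qed measurable
    also have "\<dots> \<le> (\<integral>x. exp (\<eta> * X x) \<partial>P) / exp (\<theta> * d + \<eta> * \<mu>)"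
      using int by (intro integral_Markov_inequality_measure[where A = "space P"]) auto
    also have "(\<integral>x. exp (\<eta> * X x) \<partial>P) = (1 + prob S * (exp \<eta> - 1)) ^ card I"
      unfolding P_def X_def by (rule iid_mgf_card(2)[OF J S])
    also have "\<dots> \<le> exp (prob S * (\<eta> + \<theta>\<^sup>2)) ^ card I"
    proof (rule power_mono)
      have "prob S * (exp \<eta> - 1) \<le> prob S * (\<eta> + \<theta>\<^sup>2)"
        using exp_quadratic_upper[OF \<eta>(1)] \<eta>(2) by (intro mult_left_mono) auto
      then show "1 + prob S * (exp \<eta> - 1) \<le> exp (prob S * (\<eta> + \<theta>\<^sup>2))"
        using exp_ge_add_one_self[of "prob S * (\<eta> + \<theta>\<^sup>2)"] by linarith
      have "1 + prob S * (exp \<eta> - 1) = (1 - prob S) + prob S * exp \<eta>"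
        by (simp add: algebra_simps)
      moreover have "prob S \<le> 1" "0 \<le> prob S * exp \<eta>" by simp_all
      ultimately show "0 \<le> 1 + prob S * (exp \<eta> - 1)" by linarith
    qed
    also have "\<dots> = exp (\<mu> * (\<eta> + \<theta>\<^sup>2))"
      by (simp add: \<mu>_def mult_ac flip: exp_of_nat_mult)
    finally show ?thesis
      by (simp add: divide_right_mono flip: exp_diff) (simp add: algebra_simps)
  qed
  have "{x \<in> space P. \<bar>X x - \<mu>\<bar> > d}
      = {x \<in> space P. 1 * (X x - \<mu>) > d} \<union> {x \<in> space P. (-1) * (X x - \<mu>) > d}"
    by auto
  then have "measure P {x \<in> space P. \<bar>X x - \<mu>\<bar> > d}
      \<le> measure P {x \<in> space P. 1 * (X x - \<mu>) > d}
        + measure P {x \<in> space P. (-1) * (X x - \<mu>) > d}"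
    by (simp only:) (intro measure_Un_le; measurable)
  also have "\<dots> \<le> 2 * exp (\<theta>\<^sup>2 * \<mu> - \<theta> * d)"
    using one_sided[of 1] one_sided[of "-1"] by linarith
  finally show ?thesis
    by (simp add: X_def P_def \<mu>_def)
qed

end

section \<open>Simultaneous control of all windows\<close>

definition window_count :: "real list \<Rightarrow> nat \<Rightarrow> nat \<Rightarrow> nat \<Rightarrow> nat \<Rightarrow> nat" where
  "window_count xs K a b j = card {r \<in> {a..<b}. bucket K (xs ! r) = j}"

abbreviation unif :: "real measure" where
  "unif \<equiv> uniform_measure lborel {0..1}"

lemma prob_space_unif: "prob_space unif"
  by (rule prob_space_uniform_measure) auto

lemma measure_unif_Ioc:
  assumes "0 \<le> a" "a \<le> b" "b \<le> 1"
  shows "measure unif {a<..b} = b - a"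
proof -
  have "{0..1} \<inter> {a<..b} = {a<..b}" using assms by auto
  then have "emeasure unif {a<..b} = ennreal (b - a)"
    using assms by (simp add: divide_ennreal_def)
  then show ?thesis using assms by (simp add: measure_def)
qed

text \<open>Quantifying over the endpoints inside the event is what later allows a window to start
  at the random beginning of a phase. The union bound has one term for each choice of bucket and
  window.\<close>

lemma uniform_window_concentration:
  fixes n :: nat and V :: real and P :: "(nat \<times> nat) set"
  assumes P: "finite P" "\<And>K j. (K, j) \<in> P \<Longrightarrow> j \<in> {1..K}"
  shows "\<exists>E\<in>sets (iid_uniform n).
    measure (iid_uniform n) E \<ge> 1 - 2 * real ((n + 1)\<^sup>2 * card P) * exp (- V / 4800) \<and>
    (\<forall>x\<in>E. (\<forall>r<n. 0 < x r \<and> x r \<le> 1) \<and>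
      (\<forall>K j a b. (K, j) \<in> P \<longrightarrow> a \<le> b \<longrightarrow> b \<le> n \<longrightarrow> real (b - a) \<le> 3 * V * real K \<longrightarrow>
        \<bar>real (window_count (map x [0..<n]) K a b j) - real (b - a) / real K\<bar> \<le> V / 20))"
proof -
  define M where "M = iid_uniform n"
  interpret u: prob_space unif by (rule prob_space_unif)
  have M: "M = (\<Pi>\<^sub>M r\<in>{..<n}. unif)" by (simp add: M_def iid_uniform_def)
  interpret M: prob_space M unfolding M by (intro prob_space_PiM u.prob_space_axioms)
  define S where "S = (\<lambda>K j. {(real j - 1) / real K <.. real j / real K})"
  define X where "X = (\<lambda>K j a (b::nat) x. real (card {r \<in> {a..<b}. (x r :: real) \<in> S K j}))"
  define Q where "Q = {((K, j), (a, b)). (K, j) \<in> P \<and> a \<le> b \<and> b \<le> n \<and> real (b - a) \<le> 3 * V * real K}"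
  define bad where "bad = (\<lambda>((K, j), (a, b)).
    {x \<in> space M. \<bar>X K j a b x - real (b - a) / real K\<bar> > V / 20})"
  \<comment> \<open>Removing this null set leaves numbers in \<open>(0, 1]\<close>, which the
    half-open buckets partition exactly; the exceptional input 0 of \<open>bucket\<close> no longer
    occurs.\<close>
  define Z where "Z = (\<lambda>r. {x \<in> space M. \<not> (0 < x r \<and> x r \<le> 1)})"
  have Q: "finite Q" "card Q \<le> (n + 1)\<^sup>2 * card P"
  proof -
    have sub: "Q \<subseteq> P \<times> ({..n} \<times> {..n})" by (auto simp: Q_def)
    then show "finite Q" using P(1) by (auto intro: finite_subset)
    have "card Q \<le> card (P \<times> ({..n} \<times> {..n}))"
      using sub P(1) by (intro card_mono) auto
    then show "card Q \<le> (n + 1)\<^sup>2 * card P"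
      by (simp add: card_cartesian_product power2_eq_square mult_ac)
  qed
  have S: "S K j \<in> u.events" for K j by (simp add: S_def)
  have coord: "(\<lambda>x. x r) \<in> borel_measurable M" if "r < n" for r
  proof -
    have "(\<lambda>x. x r) \<in> M \<rightarrow>\<^sub>M unif" unfolding M using that by auto
    then show ?thesis by (simp add: measurable_def)
  qed
  have Z_sets: "Z r \<in> M.events" if "r < n" for r
    using coord[OF that] unfolding Z_def by measurable
  have Z_null: "measure M (Z r) = 0" if r: "r < n" for r
  proof -
    have d: "distr M unif (\<lambda>x. x r) = unif"
      unfolding M using r by (intro distr_PiM_component u.prob_space_axioms) auto
    have "Z r = (\<lambda>x. x r) -` (- {0<..1}) \<inter> space M" by (auto simp: Z_def)
    then have "measure M (Z r) = measure (distr M unif (\<lambda>x. x r)) (- {0<..1})"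
      using r by (subst measure_distr) (auto simp: M)
    also have "\<dots> = 1 - measure unif {0<..1}"
      unfolding d by (subst u.prob_compl[symmetric]) (auto simp: Compl_eq_Diff_UNIV)
    also have "\<dots> = 0" by (subst measure_unif_Ioc) auto
    finally show ?thesis .
  qed
  have bad: "bad q \<in> M.events \<and> measure M (bad q) \<le> 2 * exp (- V / 4800)" if "q \<in> Q" for q
  proof -
    obtain K j a b where q1: "q = ((K, j), (a, b))" by (metis surj_pair)
    with that have q: "q = ((K, j), (a, b))" "(K, j) \<in> P" "a \<le> b" "b \<le> n"
      "real (b - a) \<le> 3 * V * real K"
      unfolding Q_def by (simp_all del: of_nat_diff)
    have j: "1 \<le> j" "j \<le> K" using P(2)[OF q(2)] by auto
    then have K: "real K > 0" by simp
    have p: "u.prob (S K j) = 1 / real K"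
      unfolding S_def using j by (subst measure_unif_Ioc) (auto simp: field_simps)
    have sub: "{a..<b} \<subseteq> {..<n}" using q by auto
    have X: "X K j a b \<in> borel_measurable M"
      unfolding X_def M by (rule u.iid_card_measurable[OF _ sub S]) simp
    \<comment> \<open>For mean at most \<open>3 * V\<close> and deviation \<open>V / 20\<close> the
      exponent \<open>3 * V * \<theta>^2 - \<theta> * V / 20\<close> is minimal at
      \<open>\<theta> = 1 / 120\<close>, with value \<open>- V / 4800\<close>.\<close>
    have "measure M (bad q)
        \<le> 2 * exp ((1/120)\<^sup>2 * (1 / real K * card {a..<b}) - 1/120 * (V / 20))"
      using u.iid_card_deviation[OF _ sub S[of K j], of "1/120" "V/20"]
      unfolding q(1) bad_def X_def M p by simp
    also have "\<dots> \<le> 2 * exp (- V / 4800)"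
    proof -
      have "real (b - a) / real K \<le> 3 * V" using q(5) K by (simp add: field_simps)
      then show ?thesis by (simp add: power2_eq_square)
    qed
    finally show ?thesis
      unfolding q(1) bad_def using X by simp
  qed
  define N where "N = (\<Union>r<n. Z r) \<union> (\<Union>q\<in>Q. bad q)"
  have N: "N \<in> M.events"
    unfolding N_def using Z_sets bad Q(1) by (intro sets.Un sets.finite_UN) auto
  have "measure M N \<le> measure M (\<Union>r<n. Z r) + measure M (\<Union>q\<in>Q. bad q)"
    unfolding N_def using Z_sets bad Q(1) by (intro measure_Un_le sets.finite_UN) auto
  also have "measure M (\<Union>r<n. Z r) \<le> (\<Sum>r<n. measure M (Z r))"
    using Z_sets by (intro M.finite_measure_subadditive_finite) auto
  also have "(\<Sum>r<n. measure M (Z r)) = 0" using Z_null by simp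
  also have "measure M (\<Union>q\<in>Q. bad q) \<le> (\<Sum>q\<in>Q. measure M (bad q))"
    using bad Q(1) by (intro M.finite_measure_subadditive_finite) auto
  also have "\<dots> \<le> (\<Sum>q\<in>Q. 2 * exp (- V / 4800))"
    using bad by (intro sum_mono) auto
  also have "\<dots> = real (card Q) * (2 * exp (- V / 4800))" by simp
  also have "\<dots> \<le> real ((n + 1)\<^sup>2 * card P) * (2 * exp (- V / 4800))"
    using Q(2) by (intro mult_right_mono of_nat_mono) auto
  finally have "measure M N \<le> 2 * real ((n + 1)\<^sup>2 * card P) * exp (- V / 4800)"
    by (simp add: mult_ac)
  then have "measure M (space M - N) \<ge> 1 - 2 * real ((n + 1)\<^sup>2 * card P) * exp (- V / 4800)"
    using M.prob_compl[OF N] by simp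
  moreover have "(\<forall>r<n. 0 < x r \<and> x r \<le> 1) \<and>
      (\<forall>K j a b. (K, j) \<in> P \<longrightarrow> a \<le> b \<longrightarrow> b \<le> n \<longrightarrow> real (b - a) \<le> 3 * V * real K \<longrightarrow>
        \<bar>real (window_count (map x [0..<n]) K a b j) - real (b - a) / real K\<bar> \<le> V / 20)"
    if x: "x \<in> space M - N" for x
  proof -
    have x01: "0 < x r \<and> x r \<le> 1" if "r < n" for r
      using x that by (auto simp: N_def Z_def)
    moreover have "\<bar>real (window_count (map x [0..<n]) K a b j) - real (b - a) / real K\<bar> \<le> V / 20"
      if Kj: "(K, j) \<in> P" and ab: "a \<le> b" "b \<le> n" "real (b - a) \<le> 3 * V * real K" for K j a b
    proof -
      have "((K, j), (a, b)) \<in> Q" using that by (simp add: Q_def)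
      then have "x \<notin> bad ((K, j), (a, b))" using x by (auto simp: N_def)
      then have "\<bar>X K j a b x - real (b - a) / real K\<bar> \<le> V / 20"
        using x by (auto simp: bad_def)
      moreover have "X K j a b x = real (window_count (map x [0..<n]) K a b j)"
      proof -
        have "bucket K (map x [0..<n] ! r) = j \<longleftrightarrow> x r \<in> S K j" if "r \<in> {a..<b}" for r
          using bucket_iff[of K "x r" j] x01[of r] P(2)[OF Kj] that ab by (simp add: S_def)
        then have "{r \<in> {a..<b}. bucket K (map x [0..<n] ! r) = j} = {r \<in> {a..<b}. x r \<in> S K j}"
          by blast
        then show ?thesis by (simp add: X_def window_count_def)
      qed
      ultimately show ?thesis by simp
    qed
    ultimately show ?thesis by blast
  qed
  ultimately show ?thesis
    using N unfolding M_def by (intro bexI[of _ "space M - N"]) (auto simp: M_def)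
qed

section \<open>Refinement of buckets and balance of bins at an overflow\<close>

lemma sum_pairs:
  fixes g :: "nat \<Rightarrow> nat"
  shows "(\<Sum>j=1..2 * K. g j) = (\<Sum>j=1..K. g (2 * j - 1) + g (2 * j))"
proof (induction K)
  case (Suc K)
  have "2 * Suc K = Suc (Suc (2 * K))" by simp
  then show ?case using Suc by simp
qed simp

lemma bucket_in_range:
  assumes "K > 0" "x \<in> {0<..1}"
  shows "bucket K x \<in> {1..K}" "x \<in> {(real (bucket K x) - 1) / real K..real (bucket K x) / real K}"
proof -
  have "bucket K x \<in> {1..K} \<and>
      x \<in> {(real (bucket K x) - 1) / real K<..real (bucket K x) / real K}"
    using assms by (intro bucket_iff[THEN iffD1] refl) auto
  then show "bucket K x \<in> {1..K}"
      "x \<in> {(real (bucket K x) - 1) / real K..real (bucket K x) / real K}"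
    unfolding atLeastAtMost_iff greaterThanAtMost_iff by linarith+
qed

lemma bucket_double:
  assumes "K > 0" "x \<in> {0<..1}" "1 \<le> j"
  shows "bucket K x = j \<longleftrightarrow> bucket (2 * K) x = 2 * j - 1 \<or> bucket (2 * K) x = 2 * j"
proof -
  define b where "b = bucket (2 * K) x"
  have b: "1 \<le> b" "b \<le> 2 * K" and x: "real b - 1 < 2 * real K * x" "2 * real K * x \<le> real b"
    using bucket_iff[of "2 * K" x b] assms by (auto simp: b_def field_simps)
  have iff: "bucket K x = j \<longleftrightarrow> j \<le> K \<and> real j - 1 < real K * x \<and> real K * x \<le> real j"
    using bucket_iff[of K x j] assms by (auto simp: field_simps)
  show ?thesis
  proof
    assume "bucket K x = j"
    then have "real b < 2 * real j + 1" "2 * real j - 2 < real b"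
      using iff x by linarith+
    then have "b < 2 * j + 1" "2 * j < b + 2" by linarith+
    then show "bucket (2 * K) x = 2 * j - 1 \<or> bucket (2 * K) x = 2 * j"
      unfolding b_def[symmetric] using assms(3) by linarith
  next
    assume "bucket (2 * K) x = 2 * j - 1 \<or> bucket (2 * K) x = 2 * j"
    then have "b = 2 * j - 1 \<or> b = 2 * j" by (simp add: b_def)
    then have "j \<le> K" "real b \<le> 2 * real j" "2 * real j - 1 \<le> real b"
      using b assms(3) by auto
    then show "bucket K x = j" using iff x by linarith
  qed
qed

lemma window_count_empty [simp]: "window_count xs K a a j = 0"
  by (simp add: window_count_def)

lemma window_count_Suc:
  assumes "a \<le> b"
  shows "window_count xs K a (Suc b) j
       = window_count xs K a b j + (if bucket K (xs ! b) = j then 1 else 0)"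
proof -
  have "{r \<in> {a..<Suc b}. bucket K (xs ! r) = j}
      = {r \<in> {a..<b}. bucket K (xs ! r) = j} \<union> (if bucket K (xs ! b) = j then {b} else {})"
    using assms by (auto simp: less_Suc_eq)
  then show ?thesis by (auto simp: window_count_def)
qed

lemma window_count_double:
  assumes "K > 0" "set xs \<subseteq> {0<..1}" "b \<le> length xs" "1 \<le> j"
  shows "window_count xs K a b j
       = window_count xs (2 * K) a b (2 * j - 1) + window_count xs (2 * K) a b (2 * j)"
proof -
  have "bucket K (xs ! r) = j \<longleftrightarrow>
      bucket (2 * K) (xs ! r) = 2 * j - 1 \<or> bucket (2 * K) (xs ! r) = 2 * j" if "r \<in> {a..<b}" for r
  proof (rule bucket_double[OF assms(1) _ assms(4)])
    show "xs ! r \<in> {0<..1}"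
      using assms that by (intro subsetD[OF assms(2)] nth_mem) auto
  qed
  then have "{r \<in> {a..<b}. bucket K (xs ! r) = j}
      = {r \<in> {a..<b}. bucket (2 * K) (xs ! r) = 2 * j - 1} \<union>
        {r \<in> {a..<b}. bucket (2 * K) (xs ! r) = 2 * j}"
    by blast
  moreover have "{r \<in> {a..<b}. bucket (2 * K) (xs ! r) = 2 * j - 1} \<inter>
      {r \<in> {a..<b}. bucket (2 * K) (xs ! r) = 2 * j} = {}"
    using assms(4) by auto
  ultimately show ?thesis
    unfolding window_count_def by (subst card_Un_disjoint[symmetric]) simp_all
qed

lemma sum_window_count:
  assumes "K > 0" "set xs \<subseteq> {0<..1}" "a \<le> b" "b \<le> length xs"
  shows "(\<Sum>j=1..K. window_count xs K a b j) = b - a"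
  using assms(3,4)
proof (induction b rule: dec_induct)
  case base
  then show ?case by simp
next
  case (step b)
  have "xs ! b \<in> {0<..1}"
    using step.prems by (intro subsetD[OF assms(2)] nth_mem) auto
  then have "bucket K (xs ! b) \<in> {1..K}" by (rule bucket_in_range(1)[OF assms(1)])
  then show ?case
    using step by (simp add: window_count_Suc sum.distrib Suc_diff_le)
qed

text \<open>Bucket \<open>j\<close> of the previous subarray had \<open>f j\<close> empty cells when
  the phase began, and \<open>W j\<close> numbers have been directed to it since;
  \<open>sz j\<close> is the size of the new bucket. The argument takes two rounds. An overflow
  gives a crude lower bound on the arrivals per bin, enough to fill the previous subarray; then
  truncated subtraction is exact, and the same comparison becomes sharp enough to reproduce the
  bound assumed of \<open>f\<close>.\<close>

lemma overflow_balance: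
  fixes V C :: real and K T :: nat and sz f W :: "nat \<Rightarrow> nat"
  assumes V: "V \<ge> 100" and K: "K > 0" and C: "V - 1 \<le> C" "C \<le> 2 * V + 3 * V / 10"
    and f: "\<And>j. j \<in> {1..2 * K} \<Longrightarrow> f j \<le> 3 * V / 20"
    and cap: "\<And>j. j \<in> {1..K} \<Longrightarrow> \<bar>real (sz j + f (2 * j - 1) + f (2 * j)) - C\<bar> \<le> 1"
    and len: "\<And>j. j \<in> {1..K} \<Longrightarrow>
      (W (2 * j - 1) - f (2 * j - 1)) + (W (2 * j) - f (2 * j)) \<le> sz j"
    and T: "T = (\<Sum>j=1..K. W (2 * j - 1) + W (2 * j))"
    and conc: "\<And>j. T \<le> 3 * V * K \<Longrightarrow> j \<in> {1..K} \<Longrightarrow>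
      \<bar>real (W (2 * j - 1) + W (2 * j)) - T / K\<bar> \<le> V / 20"
    and conc2: "\<And>j. T \<le> 3 * V * K \<Longrightarrow> j \<in> {1..2 * K} \<Longrightarrow> \<bar>real (W j) - T / (2 * K)\<bar> \<le> V / 20"
    and over: "j0 \<in> {1..K}"
      "(W (2 * j0 - 1) - f (2 * j0 - 1)) + (W (2 * j0) - f (2 * j0)) = sz j0"
  shows "\<And>j. j \<in> {1..2 * K} \<Longrightarrow> f j \<le> W j"
    and "\<And>j. j \<in> {1..K} \<Longrightarrow>
      real (sz j - ((W (2 * j - 1) - f (2 * j - 1)) + (W (2 * j) - f (2 * j)))) \<le> 3 * V / 20"
proof -
  \<comment> \<open>\<open>conc\<close> and \<open>conc2\<close> apply only to short windows, so the
    length has to be bounded without them: no bin has exceeded its capacity, which is at most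
    \<open>C + 1 <= 3 * V\<close>.\<close>
  have "real T = (\<Sum>j=1..K. real (W (2 * j - 1) + W (2 * j)))" by (simp add: T)
  also have "\<dots> \<le> (\<Sum>j=1..K. 3 * V)"
  proof (rule sum_mono)
    fix j assume j: "j \<in> {1..K}"
    have "W (2 * j - 1) + W (2 * j) \<le> sz j + f (2 * j - 1) + f (2 * j)"
      using len[OF j] by linarith
    then have "real (W (2 * j - 1) + W (2 * j)) \<le> real (sz j + f (2 * j - 1) + f (2 * j))"
      by (simp only: of_nat_le_iff)
    then show "real (W (2 * j - 1) + W (2 * j)) \<le> 3 * V"
      using cap[OF j] C V by linarith
  qed
  finally have TV: "real T \<le> 3 * V * K" by (simp add: mult_ac)
  have half: "T / (2 * real K) = (T / K) / 2" by simp
  have pair: "2 * j - 1 \<in> {1..2 * K}" "2 * j \<in> {1..2 * K}" if "j \<in> {1..K}" for j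
    using that by auto
  have "sz j0 \<le> W (2 * j0 - 1) + W (2 * j0)" using over(2) by linarith
  then have "real (sz j0) \<le> real (W (2 * j0 - 1) + W (2 * j0))"
    by (simp only: of_nat_le_iff)
  \<comment> \<open>The previous buckets of bin \<open>j0\<close> may still have room, so up to
    \<open>3 * V / 10\<close> of its capacity is lost here.\<close>
  then have low: "T / K \<ge> C - 1 - 3 * V / 10 - V / 20"
    using conc[OF TV over(1)] cap[OF over(1)] f[OF pair(1)[OF over(1)]] f[OF pair(2)[OF over(1)]]
    unfolding of_nat_add by linarith
  \<comment> \<open>Half of the crude bound, less \<open>V / 20\<close>, is at least
    \<open>11 * V / 40 - 1\<close>, which exceeds \<open>3 * V / 20\<close>.\<close>
  show full: "f j \<le> W j" if j: "j \<in> {1..2 * K}" for j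
  proof -
    have "real (f j) \<le> real (W j)"
      using conc2[OF TV j] low f[OF j] C V unfolding half by linarith
    then show ?thesis by simp
  qed
  define X where "X = (\<lambda>j. (W (2 * j - 1) - f (2 * j - 1)) + (W (2 * j) - f (2 * j)))"
  have bin: "X j + f (2 * j - 1) + f (2 * j) = W (2 * j - 1) + W (2 * j)" if "j \<in> {1..K}" for j
    using full[OF pair(1)[OF that]] full[OF pair(2)[OF that]] by (simp add: X_def)
  \<comment> \<open>Now the whole capacity of bin \<open>j0\<close> is known to be used, and the
    loss \<open>3 * V / 10\<close> disappears.\<close>
  have "sz j0 + f (2 * j0 - 1) + f (2 * j0) = W (2 * j0 - 1) + W (2 * j0)"
    using over(2) bin[OF over(1)] by (simp add: X_def)
  then have low': "T / K \<ge> C - 1 - V / 20"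
    using conc[OF TV over(1)] cap[OF over(1)] by linarith
  show "real (sz j - ((W (2 * j - 1) - f (2 * j - 1)) + (W (2 * j) - f (2 * j)))) \<le> 3 * V / 20"
    if j: "j \<in> {1..K}" for j
  proof -
    have "X j \<le> sz j" using len[OF j] by (simp add: X_def)
    then have "sz j - X j + (W (2 * j - 1) + W (2 * j)) = sz j + f (2 * j - 1) + f (2 * j)"
      using bin[OF j] by linarith
    then have "real (sz j - X j) + real (W (2 * j - 1) + W (2 * j))
        = real (sz j + f (2 * j - 1) + f (2 * j))"
      by (simp only: of_nat_add[symmetric])
    \<comment> \<open>Capacity at most \<open>C + 1\<close> minus at least
      \<open>C - 1 - V / 20 - V / 20\<close> arrivals leaves \<open>2 + V / 10\<close>, at most
      \<open>3 * V / 20\<close> as \<open>V >= 40\<close>.\<close>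
    then show ?thesis
      using conc[OF TV j] cap[OF j] low' V unfolding X_def by linarith
  qed
qed

section \<open>Cost of concatenated buckets\<close>

lemma array_cost_0 [simp]: "array_cost 0 A = 0"
  by (simp add: array_cost_def)

lemma array_cost_append:
  assumes "p > 0" "q > 0"
  shows "array_cost (p + q) A
       = array_cost p A + \<bar>A p - A (p - 1)\<bar> + array_cost q (\<lambda>r. A (p + r))"
proof -
  obtain p' q' where pq: "p = Suc p'" "q = Suc q'"
    using assms by (metis gr0_implies_Suc)
  have "(\<Sum>i<Suc p' + q'. \<bar>A (Suc i) - A i\<bar>)
      = (\<Sum>i<Suc p'. \<bar>A (Suc i) - A i\<bar>) + (\<Sum>i<q'. \<bar>A (Suc (Suc p' + i)) - A (Suc p' + i)\<bar>)"
    by (induction q') auto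
  then show ?thesis
    by (simp add: array_cost_def pq)
qed

text \<open>Each cell takes part in at most two of the differences, hence the factor 2.\<close>

lemma array_cost_perturb:
  "array_cost m A \<le> array_cost m V + 2 * (\<Sum>q<m. \<bar>A q - V q\<bar>)"
proof -
  define d where "d = (\<lambda>q. \<bar>A q - V q\<bar>)"
  have "array_cost m A \<le> (\<Sum>i<m - 1. \<bar>V (Suc i) - V i\<bar> + d (Suc i) + d i)"
    unfolding array_cost_def d_def by (intro sum_mono) auto
  also have "\<dots> = array_cost m V + (\<Sum>i<m - 1. d (Suc i)) + (\<Sum>i<m - 1. d i)"
    by (simp add: array_cost_def sum.distrib)
  also have "(\<Sum>i<m - 1. d (Suc i)) = sum d (Suc ` {..<m - 1})"
    by (simp add: sum.reindex)
  also have "\<dots> \<le> (\<Sum>q<m. d q)"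
    by (intro sum_mono2) (auto simp: d_def)
  also have "(\<Sum>i<m - 1. d i) \<le> (\<Sum>q<m. d q)"
    by (intro sum_mono2) (auto simp: d_def)
  finally show ?thesis by (simp add: d_def)
qed

text \<open>Applied at two scales: to the buckets inside a subarray and to the subarrays inside the
  array. The terms \<open>d\<close> pay for the seams between consecutive blocks.\<close>

lemma array_cost_blocks:
  fixes sz :: "nat \<Rightarrow> nat" and A :: "nat \<Rightarrow> real"
  defines "st \<equiv> \<lambda>j. \<Sum>j'=1..<j. sz j'"
  assumes pos: "\<And>j. j \<in> {1..J} \<Longrightarrow> sz j > 0"
    and inner: "\<And>j. j \<in> {1..J} \<Longrightarrow> array_cost (sz j) (\<lambda>q. A (st j + q)) \<le> b j"
    and jump: "\<And>j. j \<in> {1..J} \<Longrightarrow> j < J \<Longrightarrow> \<bar>A (st (Suc j)) - A (st (Suc j) - 1)\<bar> \<le> d"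
    and d: "d \<ge> 0"
  shows "array_cost (\<Sum>j=1..J. sz j) A \<le> (\<Sum>j=1..J. b j) + real J * d"
  using pos inner jump
proof (induction J)
  case 0
  then show ?case by simp
next
  case (Suc J)
  have IH: "array_cost (\<Sum>j=1..J. sz j) A \<le> (\<Sum>j=1..J. b j) + real J * d"
    by (rule Suc.IH) (use Suc.prems in auto)
  have st: "st (Suc J) = (\<Sum>j=1..J. sz j)"
    by (simp add: st_def atLeastLessThanSuc_atLeastAtMost)
  have last: "array_cost (sz (Suc J)) (\<lambda>q. A (st (Suc J) + q)) \<le> b (Suc J)" "sz (Suc J) > 0"
    using Suc.prems by auto
  show ?case
  proof (cases "J = 0")
    case True
    then show ?thesis using last st d by simp
  next
    case False
    then have "0 < (\<Sum>j=1..J. sz j)"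
      using Suc.prems(1) by (intro sum_pos) auto
    from array_cost_append[OF this last(2), of A]
    have "array_cost (\<Sum>j=1..Suc J. sz j) A
        = array_cost (\<Sum>j=1..J. sz j) A + \<bar>A (st (Suc J)) - A (st (Suc J) - 1)\<bar>
          + array_cost (sz (Suc J)) (\<lambda>q. A (st (Suc J) + q))"
      by (simp add: st)
    moreover have "\<bar>A (st (Suc J)) - A (st (Suc J) - 1)\<bar> \<le> d"
      using Suc.prems(3)[of J] False by simp
    ultimately show ?thesis
      using IH last(1) by (simp add: algebra_simps)
  qed
qed

text \<open>The definition speaks of full inputs only. Padding with copies of \<open>a\<close>
  completes the input without changing the earlier calls, because \<open>adv\<close> sees only the
  numbers revealed so far.\<close>

lemma online_sorting_prefix:
  assumes adv: "online_sorting_algorithm adv"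
    and "a < b" "length xs \<le> m" "set xs \<subseteq> {a..b}"
  shows "inj_on (\<lambda>r. adv m a b (take (Suc r) xs)) {..<length xs}"
    and "\<And>r. r < length xs \<Longrightarrow> adv m a b (take (Suc r) xs) < m"
proof -
  define ys where "ys = xs @ replicate (m - length xs) a"
  have "length ys = m" "set ys \<subseteq> {a..b}"
    using assms(2-4) by (auto simp: ys_def)
  then have "bij_betw (\<lambda>t. adv m a b (take (Suc t) ys)) {..<m} {..<m}"
    using adv assms(2) unfolding online_sorting_algorithm_def by auto
  then have inj: "inj_on (\<lambda>t. adv m a b (take (Suc t) ys)) {..<m}"
    and im: "\<And>t. t < m \<Longrightarrow> adv m a b (take (Suc t) ys) < m"
    by (auto simp: bij_betw_def)
  have eq: "take (Suc r) ys = take (Suc r) xs" if "r < length xs" for r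
    using that by (simp add: ys_def)
  show "adv m a b (take (Suc r) xs) < m" if "r < length xs" for r
    using im[of r] eq[OF that] that assms(3) by simp
  show "inj_on (\<lambda>r. adv m a b (take (Suc r) xs)) {..<length xs}"
  proof (rule inj_onI)
    fix r r' assume *: "r \<in> {..<length xs}" "r' \<in> {..<length xs}"
      "adv m a b (take (Suc r) xs) = adv m a b (take (Suc r') xs)"
    then have "adv m a b (take (Suc r) ys) = adv m a b (take (Suc r') ys)"
      by (simp add: eq)
    then show "r = r'" using inj * assms(3) by (auto dest!: inj_onD)
  qed
qed

lemma online_sorting_full_range:
  assumes adv: "online_sorting_algorithm adv"
    and "a < b" "length xs = m" "set xs \<subseteq> {a..b}"
    and A: "\<And>t. t < m \<Longrightarrow> A (adv m a b (take (Suc t) xs)) = xs ! t"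
    and "q < m"
  shows "A q \<in> {a..b}"
proof -
  have "bij_betw (\<lambda>t. adv m a b (take (Suc t) xs)) {..<m} {..<m}"
    using adv assms(2-4) unfolding online_sorting_algorithm_def by auto
  then obtain t where "t < m" "q = adv m a b (take (Suc t) xs)"
    using \<open>q < m\<close> unfolding bij_betw_def by auto
  moreover have "xs ! t \<in> {a..b}"
    using calculation assms(3,4) nth_mem[of t xs] by blast
  ultimately show ?thesis using A[of t] by simp
qed

text \<open>
  Complete the input with copies of \<open>a\<close> and compare with the array that the rule would then have
  produced.
\<close>

lemma partial_bucket_cost:
  assumes adv: "online_sorting_algorithm adv"
    and cost: "\<And>m a b xs A. a < b \<Longrightarrow> length xs = m \<Longrightarrow> set xs \<subseteq> {a..b} \<Longrightarrow>
      (\<And>t. t < m \<Longrightarrow> A (adv m a b (take (Suc t) xs)) = xs ! t) \<Longrightarrow>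
      array_cost m A \<le> c * sqrt (real m) * (b - a)"
    and ab: "a < b" "0 \<le> a" "b \<le> 1" and xs: "length xs \<le> m" "set xs \<subseteq> {a..b}"
    and A: "\<And>t. t < length xs \<Longrightarrow> A (adv m a b (take (Suc t) xs)) = xs ! t"
    and A01: "\<And>q. q < m \<Longrightarrow> A q \<in> {0..1}"
  shows "array_cost m A \<le> c * sqrt (real m) * (b - a) + 2 * real (m - length xs)"
proof -
  define ys where "ys = xs @ replicate (m - length xs) a"
  define f where "f = (\<lambda>t. adv m a b (take (Suc t) ys))"
  have ys: "length ys = m" "set ys \<subseteq> {a..b}"
    using ab xs by (auto simp: ys_def)
  have bij: "bij_betw f {..<m} {..<m}"
    using adv ab ys unfolding online_sorting_algorithm_def f_def by auto
  \<comment> \<open>\<open>V\<close> is the array that the completed input would produce: cell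
    \<open>q\<close> holds the number whose arrival time is mapped to \<open>q\<close>.\<close>
  define V where "V = (\<lambda>q. ys ! the_inv_into {..<m} f q)"
  have V: "V (f t) = ys ! t" if "t < m" for t
    using bij that by (simp add: V_def the_inv_into_f_f bij_betw_def)
  have "array_cost m V \<le> c * sqrt (real m) * (b - a)"
    using V ys ab by (intro cost[of a b ys]) (auto simp: f_def)
  moreover have "(\<Sum>q<m. \<bar>A q - V q\<bar>) \<le> real (m - length xs)"
  proof -
    \<comment> \<open>Indexed by arrival time, the two arrays agree at the genuine arrivals; at the
      padding they differ by at most 1, all values being in \<open>[0, 1]\<close>.\<close>
    have "(\<Sum>q<m. \<bar>A q - V q\<bar>) = (\<Sum>t<m. \<bar>A (f t) - V (f t)\<bar>)"
      using sum.reindex_bij_betw[OF bij, of "\<lambda>q. \<bar>A q - V q\<bar>"] by simp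
    also have "\<dots> \<le> (\<Sum>t<m. if t < length xs then 0 else 1)"
    proof (rule sum_mono)
      fix t assume t: "t \<in> {..<m}"
      show "\<bar>A (f t) - V (f t)\<bar> \<le> (if t < length xs then 0 else 1)"
      proof (cases "t < length xs")
        case True
        then show ?thesis using t A[of t] V[of t] by (simp add: f_def ys_def nth_append)
      next
        case False
        have "f t < m" using bij t by (auto simp: bij_betw_def)
        then have "A (f t) \<in> {0..1}" by (rule A01)
        moreover have "ys ! t \<in> {a..b}"
          using t ys nth_mem[of t ys] by blast
        then have "V (f t) \<in> {0..1}"
          using V[of t] t ab by auto
        ultimately show ?thesis using False by auto
      qed
    qed
    also have "\<dots> = real (m - length xs)"
    proof -
      have "{..<m} \<inter> - {t. t < length xs} = {length xs..<m}" by auto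
      then show ?thesis by (simp add: sum.If_cases)
    qed
    finally show ?thesis .
  qed
  ultimately show ?thesis using array_cost_perturb[of m A V] by linarith
qed

section \<open>Layout of the array\<close>

text \<open>All randomness is condensed into \<open>concentrated\<close>. Its level starts at 0,
  since Phase 1 is treated as following a fictitious \<open>A\<^sub>0\<close> with
  \<open>2 * K 1\<close> buckets. The loss from \<open>V\<close> to \<open>V - 1\<close> in
  \<open>sub_len_lower\<close> accounts for the floor in \<open>sub_len\<close>.\<close>

locale phased_run = phased_sorting n adv split spill
  for n adv split spill +
  fixes xs :: "real list" and V :: real
  assumes adv: "online_sorting_algorithm adv"
    and split: "balanced_split split"
    and spill: "chooses_member spill"
    and length_xs: "length xs = n"
    and set_xs: "set xs \<subseteq> {0<..1}"
    and V_large: "V \<ge> 100"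
    and num_subs: "1 \<le> num_subs n" "num_subs n \<le> ell n"
    and total_len: "(\<Sum>i=1..num_subs n. sub_len n i) < n"
    and sub_len_lower: "\<And>i. i \<in> {1..num_subs n} \<Longrightarrow> (V - 1) * num_buckets n i \<le> sub_len n i"
    and sub_len_upper: "\<And>i. i \<in> {1..num_subs n} \<Longrightarrow> sub_len n i \<le> 2 * V * num_buckets n i"
    and concentrated: "\<And>i j a b. i \<le> num_subs n \<Longrightarrow> j \<in> {1..num_buckets n i} \<Longrightarrow>
      a \<le> b \<Longrightarrow> b \<le> n \<Longrightarrow> real (b - a) \<le> 3 * V * num_buckets n i \<Longrightarrow>
      \<bar>real (window_count xs (num_buckets n i) a b j) - real (b - a) / num_buckets n i\<bar> \<le> V / 20"
begin

abbreviation "k \<equiv> num_subs n"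
abbreviation "K \<equiv> num_buckets n"

text \<open>\<open>B\<close> is treated as one more subarray, of index \<open>Suc k\<close> and with a single bucket.\<close>

definition rowK :: "nat \<Rightarrow> nat" where
  "rowK i = (if i \<le> k then K i else 1)"

definition rowlen :: "nat \<Rightarrow> nat" where
  "rowlen i = (if i \<le> k then sub_len n i else B_len n)"

definition row_start :: "nat \<Rightarrow> nat" where
  "row_start i = (\<Sum>i'=1..<i. rowlen i')"

definition lo :: "nat \<Rightarrow> nat \<Rightarrow> real" where
  "lo i j = (real j - 1) / real (rowK i)"

definition hi :: "nat \<Rightarrow> nat \<Rightarrow> real" where
  "hi i j = real j / real (rowK i)"

definition start :: "(nat \<Rightarrow> nat \<Rightarrow> nat) \<Rightarrow> nat \<Rightarrow> nat \<Rightarrow> nat" where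
  "start sz i j = row_start i + (\<Sum>j'=1..<j. sz i j')"

text \<open>The cell of an item is recomputed from the list of its bucket instead of being stored.
  It stays fixed because lists grow only at the end and a subarray gets its bucket sizes while it is
  still empty.\<close>

definition pos :: "(nat \<Rightarrow> nat \<Rightarrow> nat) \<Rightarrow> (nat \<Rightarrow> nat \<Rightarrow> real list) \<Rightarrow> nat \<Rightarrow> nat \<Rightarrow> nat \<Rightarrow> nat" where
  "pos sz it i j r = start sz i j + adv (sz i j) (lo i j) (hi i j) (take (Suc r) (it i j))"

text \<open>The sizes need not add up to the row length, since a subarray whose phase has not begun
  has all bucket sizes 0.\<close>

definition buckets_ok :: "(nat \<Rightarrow> nat \<Rightarrow> nat) \<Rightarrow> (nat \<Rightarrow> nat \<Rightarrow> real list) \<Rightarrow> bool" where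
  "buckets_ok sz it \<longleftrightarrow> (\<forall>i\<in>{1..Suc k}. (\<Sum>j=1..rowK i. sz i j) \<le> rowlen i \<and>
     (\<forall>j\<in>{1..rowK i}. length (it i j) \<le> sz i j \<and> set (it i j) \<subseteq> {lo i j..hi i j}))"

text \<open>Further occupied cells are allowed: numbers placed by \<open>spill\<close> belong to no
  bucket.\<close>

definition layout :: "(nat \<Rightarrow> nat \<Rightarrow> nat) \<Rightarrow> (nat \<Rightarrow> nat \<Rightarrow> real list) \<Rightarrow> (nat \<Rightarrow> real option) \<Rightarrow> bool" where
  "layout sz it ar \<longleftrightarrow> buckets_ok sz it \<and>
     (\<forall>i\<in>{1..Suc k}. \<forall>j\<in>{1..rowK i}. \<forall>r<length (it i j). ar (pos sz it i j r) = Some (it i j ! r)) \<and>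
     dom ar \<subseteq> {..<n} \<and> ran ar \<subseteq> {0..1}"

definition slots :: "(nat \<Rightarrow> nat \<Rightarrow> real list) \<Rightarrow> (nat \<times> nat \<times> nat) set" where
  "slots it = (SIGMA i:{1..Suc k}. SIGMA j:{1..rowK i}. {..<length (it i j)})"

definition num_items :: "(nat \<Rightarrow> nat \<Rightarrow> real list) \<Rightarrow> nat" where
  "num_items it = (\<Sum>i=1..Suc k. \<Sum>j=1..rowK i. length (it i j))"

section \<open>Disjoint blocks and counting of occupied cells\<close>

lemma K_pos [simp]: "K i > 0"
  by (simp add: num_buckets_def)

lemma K_double: "1 \<le> i \<Longrightarrow> i \<le> k \<Longrightarrow> K (i - 1) = 2 * K i"
  using num_subs by (simp add: num_buckets_def Suc_diff_le flip: power_Suc)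

lemma rowK_pos [simp]: "rowK i > 0"
  by (simp add: rowK_def)

lemma lo_less_hi: "lo i j < hi i j"
  by (simp add: lo_def hi_def divide_strict_right_mono)

lemma bucket_bounds: "j \<in> {1..rowK i} \<Longrightarrow> 0 \<le> lo i j \<and> hi i j \<le> 1"
  by (auto simp: lo_def hi_def)

lemma row_start_Suc: "1 \<le> i \<Longrightarrow> row_start (Suc i) = row_start i + rowlen i"
  by (simp add: row_start_def)

lemma row_start_mono: "i \<le> i' \<Longrightarrow> row_start i \<le> row_start i'"
  unfolding row_start_def by (intro sum_mono2) auto

lemma row_start_eq: "i \<le> Suc k \<Longrightarrow> row_start i = (\<Sum>i'=1..<i. sub_len n i')"
  unfolding row_start_def rowlen_def by (intro sum.cong) auto

lemma row_start_end: "row_start (Suc (Suc k)) = n"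
proof -
  have "row_start (Suc k) = (\<Sum>i'=1..k. sub_len n i')"
    by (subst row_start_eq) (auto simp: atLeastLessThanSuc_atLeastAtMost)
  moreover have "row_start (Suc (Suc k)) = row_start (Suc k) + B_len n"
    by (subst row_start_Suc) (auto simp: rowlen_def)
  ultimately show ?thesis using total_len by (simp add: B_len_def)
qed

lemma start_le_row_end:
  assumes "buckets_ok sz it" "i \<in> {1..Suc k}" "j \<in> {1..rowK i}"
  shows "start sz i j + sz i j \<le> row_start (Suc i)"
proof -
  have "(\<Sum>j'=1..<j. sz i j') + sz i j = (\<Sum>j'=1..<Suc j. sz i j')"
    using assms(3) by simp
  also have "\<dots> \<le> (\<Sum>j'=1..rowK i. sz i j')"
    using assms(3) by (intro sum_mono2) auto
  also have "\<dots> \<le> rowlen i" using assms by (auto simp: buckets_ok_def)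
  finally show ?thesis using assms(2) by (simp add: start_def row_start_Suc)
qed

lemma start_mono_row:
  assumes "1 \<le> j" "j < j'"
  shows "start sz i j + sz i j \<le> start sz i j'"
proof -
  have "(\<Sum>j''=1..<j. sz i j'') + sz i j = (\<Sum>j''=1..<Suc j. sz i j'')"
    using assms by simp
  also have "\<dots> \<le> (\<Sum>j''=1..<j'. sz i j'')"
    using assms by (intro sum_mono2) auto
  finally show ?thesis by (simp add: start_def)
qed

lemma blocks_ordered:
  assumes "buckets_ok sz it" "i \<in> {1..Suc k}" "j \<in> {1..rowK i}"
    and "i < i' \<or> i = i' \<and> j < j'"
  shows "start sz i j + sz i j \<le> start sz i' j'"
  using assms(4)
proof
  assume "i < i'"
  then have "row_start (Suc i) \<le> row_start i'" by (intro row_start_mono) auto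
  then show ?thesis
    using start_le_row_end[OF assms(1-3)] by (simp add: start_def)
next
  assume "i = i' \<and> j < j'"
  then show ?thesis using start_mono_row[of j j' sz i] assms(3) by auto
qed

lemma block_le_n:
  assumes "buckets_ok sz it" "i \<in> {1..Suc k}" "j \<in> {1..rowK i}"
  shows "start sz i j + sz i j \<le> n"
  using start_le_row_end[OF assms] row_start_mono[of "Suc i" "Suc (Suc k)"] row_start_end assms(2)
  by auto

lemma pos_in_block:
  assumes "buckets_ok sz it" "i \<in> {1..Suc k}" "j \<in> {1..rowK i}" "r < length (it i j)"
  shows "start sz i j \<le> pos sz it i j r" "pos sz it i j r < start sz i j + sz i j"
proof -
  have "length (it i j) \<le> sz i j" "set (it i j) \<subseteq> {lo i j..hi i j}"
    using assms(1-3) by (auto simp: buckets_ok_def)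
  from online_sorting_prefix(2)[OF adv lo_less_hi this assms(4)]
  show "start sz i j \<le> pos sz it i j r" "pos sz it i j r < start sz i j + sz i j"
    by (auto simp: pos_def)
qed

lemma pos_inject:
  assumes ok: "buckets_ok sz it"
    and a: "i \<in> {1..Suc k}" "j \<in> {1..rowK i}" "r < length (it i j)"
    and b: "i' \<in> {1..Suc k}" "j' \<in> {1..rowK i'}" "r' < length (it i' j')"
    and eq: "pos sz it i j r = pos sz it i' j' r'"
  shows "i = i' \<and> j = j' \<and> r = r'"
proof -
  note A = pos_in_block[OF ok a] and B = pos_in_block[OF ok b]
  have "\<not> (i < i' \<or> i = i' \<and> j < j')"
    using blocks_ordered[OF ok a(1,2), of i' j'] A(2) B(1) eq by auto
  moreover have "\<not> (i' < i \<or> i' = i \<and> j' < j)"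
    using blocks_ordered[OF ok b(1,2), of i j] A(1) B(2) eq by auto
  ultimately have ij: "i = i'" "j = j'" by auto
  have "length (it i j) \<le> sz i j" "set (it i j) \<subseteq> {lo i j..hi i j}"
    using ok a by (auto simp: buckets_ok_def)
  from online_sorting_prefix(1)[OF adv lo_less_hi this] eq a b ij
  show ?thesis by (auto simp: pos_def dest: inj_onD)
qed

lemma card_slots: "finite (slots it)" "card (slots it) = num_items it"
  by (auto simp: slots_def num_items_def)

lemma num_items_le_card_dom:
  assumes lay: "layout sz it ar"
  shows "num_items it \<le> card (dom ar)"
proof -
  have ok: "buckets_ok sz it" using lay by (simp add: layout_def)
  have "inj_on (\<lambda>(i, j, r). pos sz it i j r) (slots it)"
  proof (rule inj_onI)
    fix u v
    assume *: "u \<in> slots it" "v \<in> slots it"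
      "(\<lambda>(i, j, r). pos sz it i j r) u = (\<lambda>(i, j, r). pos sz it i j r) v"
    obtain i j r i' j' r' where "u = (i, j, r)" "v = (i', j', r')" by (metis surj_pair)
    with * show "u = v"
      using pos_inject[OF ok, of i j r i' j' r'] by (simp add: slots_def)
  qed
  then have "num_items it = card ((\<lambda>(i, j, r). pos sz it i j r) ` slots it)"
    by (simp add: card_image card_slots)
  also have "\<dots> \<le> card (dom ar)"
  proof (rule card_mono)
    show "finite (dom ar)" using lay by (auto simp: layout_def intro: finite_subset)
    show "(\<lambda>(i, j, r). pos sz it i j r) ` slots it \<subseteq> dom ar"
      using lay by (auto simp: layout_def slots_def)
  qed
  finally show ?thesis .
qed

definition add_item :: "nat \<Rightarrow> nat \<Rightarrow> real \<Rightarrow> (nat \<Rightarrow> nat \<Rightarrow> real list) \<Rightarrow> (nat \<Rightarrow> nat \<Rightarrow> real list)" where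
  "add_item i j x it = it(i := (it i)(j := it i j @ [x]))"

lemma num_items_add_item:
  assumes "i \<in> {1..Suc k}" "j \<in> {1..rowK i}"
  shows "num_items (add_item i j x it) = Suc (num_items it)"
proof -
  have row: "(\<Sum>j'=1..rowK i'. length (add_item i j x it i' j'))
      = (\<Sum>j'=1..rowK i'. length (it i' j')) + (if i' = i then 1 else 0)" for i'
  proof (cases "i' = i")
    case True
    have "(\<Sum>j'=1..rowK i. length (add_item i j x it i j'))
        = (\<Sum>j'=1..rowK i. length (it i j') + (if j' = j then 1 else 0))"
      by (intro sum.cong) (auto simp: add_item_def)
    then show ?thesis using True assms by (simp add: sum.distrib)
  qed (simp add: add_item_def)
  show ?thesis using assms unfolding num_items_def row by (simp add: sum.distrib)
qed

lemma layout_add_item: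
  assumes lay: "layout sz it ar"
    and ij: "i \<in> {1..Suc k}" "j \<in> {1..rowK i}"
    and room: "length (it i j) < sz i j" and x: "x \<in> {lo i j..hi i j}"
  defines "it' \<equiv> add_item i j x it"
  shows "layout sz it' (ar(pos sz it' i j (length (it i j)) \<mapsto> x))"
proof -
  let ?p = "pos sz it' i j (length (it i j))"
  have ok: "buckets_ok sz it" using lay by (simp add: layout_def)
  have ok': "buckets_ok sz it'"
    unfolding buckets_ok_def
  proof (intro ballI conjI)
    fix a b assume ab: "a \<in> {1..Suc k}" "b \<in> {1..rowK a}"
    have "length (it a b) \<le> sz a b" "set (it a b) \<subseteq> {lo a b..hi a b}"
      using ok ab by (auto simp: buckets_ok_def)
    then show "length (it' a b) \<le> sz a b" "set (it' a b) \<subseteq> {lo a b..hi a b}"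
      using room x by (auto simp: it'_def add_item_def)
  qed (use ok in \<open>auto simp: buckets_ok_def\<close>)
  have len: "length (it' i j) = Suc (length (it i j))"
    by (simp add: it'_def add_item_def)
  \<comment> \<open>Appending \<open>x\<close> moves no earlier item, since its position depends
    only on a prefix of the list.\<close>
  have old: "pos sz it' a b r = pos sz it a b r" "it' a b ! r = it a b ! r" "r < length (it' a b)"
    if "r < length (it a b)" for a b r
    using that by (auto simp: pos_def it'_def add_item_def nth_append)
  have p: "?p < n"
    using pos_in_block(2)[OF ok' ij, of "length (it i j)"] block_le_n[OF ok' ij] len by simp
  have "(ar(?p \<mapsto> x)) (pos sz it' a b r) = Some (it' a b ! r)"
    if ab: "a \<in> {1..Suc k}" "b \<in> {1..rowK a}" and r: "r < length (it' a b)" for a b r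
  proof (cases "r < length (it a b)")
    case True
    then have "pos sz it' a b r \<noteq> ?p"
      using pos_inject[OF ok' ab r ij, of "length (it i j)"] len by auto
    then show ?thesis
      using lay ab True old[OF True] by (auto simp: layout_def)
  next
    case False
    then have "a = i \<and> b = j \<and> r = length (it i j)"
      using r by (auto simp: it'_def add_item_def split: if_splits)
    then show ?thesis by (simp add: it'_def add_item_def)
  qed
  moreover have "ran (ar(?p \<mapsto> x)) \<subseteq> {0..1}"
  proof -
    have "ran (ar(?p \<mapsto> x)) \<subseteq> insert x (ran ar)" by (auto simp: ran_def)
    moreover have "x \<in> {0..1}" "ran ar \<subseteq> {0..1}"
      using lay x bucket_bounds[OF ij(2)] by (auto simp: layout_def)
    ultimately show ?thesis by blast
  qed
  moreover have "dom (ar(?p \<mapsto> x)) \<subseteq> {..<n}"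
    using p lay by (auto simp: layout_def)
  ultimately show ?thesis
    using ok' unfolding layout_def by blast
qed

text \<open>That the target cell was empty follows by counting: the domain grows by at most one, yet
  it has to contain \<open>Suc t\<close> distinct item positions.\<close>

lemma layout_add_item_card:
  assumes lay: "layout sz it ar"
    and ij: "i \<in> {1..Suc k}" "j \<in> {1..rowK i}"
    and room: "length (it i j) < sz i j" and x: "x \<in> {lo i j..hi i j}"
    and t: "num_items it = t" "card (dom ar) = t"
  defines "it' \<equiv> add_item i j x it"
  shows "card (dom (ar(pos sz it' i j (length (it i j)) \<mapsto> x))) = Suc t"
proof -
  have fin: "finite (dom ar)" using lay by (auto simp: layout_def intro: finite_subset)
  have "card (dom (ar(pos sz it' i j (length (it i j)) \<mapsto> x))) \<le> Suc t"
    using t fin by (simp add: card_insert_if)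
  moreover have "Suc t \<le> card (dom (ar(pos sz it' i j (length (it i j)) \<mapsto> x)))"
    using num_items_le_card_dom[OF layout_add_item[OF lay ij room x]] t
      num_items_add_item[OF ij, of x it] by (simp add: it'_def)
  ultimately show ?thesis by simp
qed

lemma layout_spill:
  fixes h :: "real list"
  assumes lay: "layout sz it ar" and card: "card (dom ar) < n" and x: "x \<in> {0..1}"
  defines "p \<equiv> spill h {p. p < n \<and> ar p = None}"
  shows "layout sz it (ar(p \<mapsto> x))" "card (dom (ar(p \<mapsto> x))) = Suc (card (dom ar))"
proof -
  have fin: "finite (dom ar)" using lay by (auto simp: layout_def intro: finite_subset)
  have "\<not> {..<n} \<subseteq> dom ar"
    using card_mono[OF fin, of "{..<n}"] card by auto
  then have "{p. p < n \<and> ar p = None} \<noteq> {}" by auto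
  moreover have "finite {p. p < n \<and> ar p = None}" by simp
  ultimately have p: "p < n" "ar p = None"
    using spill unfolding chooses_member_def p_def by blast+
  show "card (dom (ar(p \<mapsto> x))) = Suc (card (dom ar))"
    using p fin by (simp add: card_insert_if domIff)
  have "ran (ar(p \<mapsto> x)) \<subseteq> insert x (ran ar)" by (auto simp: ran_def)
  then have "ran (ar(p \<mapsto> x)) \<subseteq> {0..1}" using lay x unfolding layout_def by blast
  moreover have "dom (ar(p \<mapsto> x)) \<subseteq> {..<n}" using p lay by (auto simp: layout_def)
  moreover have "(ar(p \<mapsto> x)) q = Some y" if "ar q = Some y" for q y using p that by auto
  ultimately show "layout sz it (ar(p \<mapsto> x))"
    using lay unfolding layout_def by blast
qed

end

section \<open>The invariant of the phases\<close>

context phased_run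
begin

lemma xs_nth: "t < n \<Longrightarrow> xs ! t \<in> {0<..1}"
  using length_xs by (intro subsetD[OF set_xs] nth_mem) auto

definition sizes :: "state \<Rightarrow> nat \<Rightarrow> nat \<Rightarrow> nat" where
  "sizes s i j = (if i \<le> k then bucket_size s i j else B_len n)"

definition contents :: "state \<Rightarrow> nat \<Rightarrow> nat \<Rightarrow> real list" where
  "contents s i j = (if i \<le> k then items s i j else if i = Suc k \<and> j = 1 then B_items s else [])"

text \<open>Both counts equal the number of arrivals: nothing has been overwritten, and nothing has
  been spilled.\<close>

definition tidy :: "nat \<Rightarrow> state \<Rightarrow> bool" where
  "tidy t s \<longleftrightarrow> layout (sizes s) (contents s) (arr s) \<and> num_items (contents s) = t \<and>
     card (dom (arr s)) = t"

definition rows_ok :: "nat \<Rightarrow> state \<Rightarrow> bool" where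
  "rows_ok i s \<longleftrightarrow> (\<forall>i'\<in>{1..i}. (\<Sum>j=1..K i'. bucket_size s i' j) = sub_len n i' \<and>
     (\<forall>j\<in>{1..K i'}. 1 \<le> bucket_size s i' j \<and> real (bucket_size s i' j) \<le> 3 * V))"

definition rows_full :: "nat \<Rightarrow> state \<Rightarrow> bool" where
  "rows_full i s \<longleftrightarrow> (\<forall>i'\<in>{1..<i}. \<forall>j\<in>{1..K i'}. length (items s i' j) = bucket_size s i' j)"

text \<open>Index 0 is included so that the fictitious \<open>A\<^sub>0\<close> has no free cells
  and Phase 1 follows the pattern of the later phases.\<close>

definition rows_empty :: "nat \<Rightarrow> state \<Rightarrow> bool" where
  "rows_empty i s \<longleftrightarrow> (\<forall>i' j. i' = 0 \<or> i < i' \<longrightarrow> bucket_size s i' j = 0 \<and> items s i' j = [])"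

text \<open>
  \<open>a\<close> is the time at which the phase started, \<open>f j\<close> the number of cells of bucket \<open>j\<close> of
  \<open>A\<^sub>i\<^sub>-\<^sub>1\<close> that were empty then, and \<open>C\<close> the average bin capacity. Subtraction is truncated: the
  \<open>W j\<close> numbers that have since arrived for bucket \<open>j\<close> of \<open>A\<^sub>i\<^sub>-\<^sub>1\<close> first use up its empty cells,
  the excess goes to \<open>A\<^sub>i\<close>. For \<open>i = 1\<close> this refers to a fictitious \<open>A\<^sub>0\<close> without cells.
\<close>

definition bins :: "nat \<Rightarrow> nat \<Rightarrow> state \<Rightarrow> bool" where
  "bins t i s \<longleftrightarrow> (\<exists>a f C. let W = window_count xs (K (i - 1)) a t in
     a \<le> t \<and> V - 1 \<le> C \<and> C \<le> 2 * V + 3 * V / 10 \<and>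
     (\<forall>j\<in>{1..K (i - 1)}. real (f j) \<le> 3 * V / 20) \<and>
     (\<forall>j\<in>{1..K i}. \<bar>real (bucket_size s i j + f (2 * j - 1) + f (2 * j)) - C\<bar> \<le> 1) \<and>
     (\<forall>j\<in>{1..K (i - 1)}. free_cells s (i - 1) j = f j - W j) \<and>
     (\<forall>j\<in>{1..K i}. length (items s i j)
        = (W (2 * j - 1) - f (2 * j - 1)) + (W (2 * j) - f (2 * j))))"

text \<open>Fullness is demanded only up to \<open>A\<^sub>i\<^sub>-\<^sub>2\<close>: in Phase
  \<open>i\<close> the subarray \<open>A\<^sub>i\<^sub>-\<^sub>1\<close> is still being
  filled.\<close>

definition phase_inv :: "nat \<Rightarrow> nat \<Rightarrow> state \<Rightarrow> bool" where
  "phase_inv t i s \<longleftrightarrow> mode s = Phase i \<and> i \<in> {1..k} \<and> tidy t s \<and> B_items s = [] \<and>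
     rows_ok i s \<and> rows_full (i - 1) s \<and> rows_empty i s \<and> bins t i s"

text \<open>Spilling starts only when \<open>B\<close> is full, so as long as \<open>B\<close> has
  room every arrival is a listed item. This is the final disjunction, and it lets the counting
  argument for empty target cells still work for \<open>B\<close>.\<close>

definition final_inv :: "nat \<Rightarrow> state \<Rightarrow> bool" where
  "final_inv t s \<longleftrightarrow> mode s = Final \<and> rows_ok k s \<and> rows_full k s \<and>
     (\<forall>j\<in>{1..K k}. real (free_cells s k j) \<le> 3 * V / 20) \<and>
     layout (sizes s) (contents s) (arr s) \<and> card (dom (arr s)) = t \<and>
     (length (B_items s) = B_len n \<or> num_items (contents s) = t)"

section \<open>Inserting a number during a phase\<close>

lemma put_bucket_simps:
  "mode (put_bucket i j x s) = mode s"
  "bucket_size (put_bucket i j x s) = bucket_size s"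
  "B_items (put_bucket i j x s) = B_items s"
  "items (put_bucket i j x s) = add_item i j x (items s)"
  "sizes (put_bucket i j x s) = sizes s"
  by (auto simp: put_bucket_def Let_def add_item_def sizes_def fun_eq_iff)

lemma contents_put_bucket:
  "i \<le> k \<Longrightarrow> contents (put_bucket i j x s) = add_item i j x (contents s)"
  by (auto simp: put_bucket_def Let_def add_item_def contents_def fun_eq_iff)

lemma arr_put_bucket:
  assumes "i \<in> {1..k}"
  shows "arr (put_bucket i j x s) =
    (arr s)(pos (sizes s) (add_item i j x (contents s)) i j (length (contents s i j)) \<mapsto> x)"
  using assms
  by (simp add: put_bucket_def Let_def pos_def start_def row_start_eq lo_def hi_def rowK_def
      sizes_def contents_def add_item_def)

lemma free_cells_put_bucket:
  "free_cells (put_bucket i j x s) i' j' = free_cells s i' j' - (if i' = i \<and> j' = j then 1 else 0)"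
  by (auto simp: free_cells_def put_bucket_simps add_item_def)

lemma layout_length_le:
  assumes "layout (sizes s) (contents s) ar" "i \<in> {1..k}" "j \<in> {1..K i}"
  shows "length (items s i j) \<le> bucket_size s i j"
proof -
  have "buckets_ok (sizes s) (contents s)" using assms by (simp add: layout_def)
  then have "length (contents s i j) \<le> sizes s i j"
    using assms by (auto simp: buckets_ok_def rowK_def)
  then show ?thesis using assms by (simp add: contents_def sizes_def)
qed

lemma tidy_put_bucket:
  assumes tidy: "tidy t s" and i: "i \<in> {1..k}" and x: "x \<in> {0<..1}"
    and j: "j = bucket (K i) x" and free: "free_cells s i j > 0"
  shows "tidy (Suc t) (put_bucket i j x s)"
proof -
  have ij: "i \<in> {1..Suc k}" "j \<in> {1..rowK i}"
    using i bucket_in_range(1)[OF _ x, of "K i"] j by (auto simp: rowK_def)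
  have room: "length (contents s i j) < sizes s i j"
    using free i by (simp add: free_cells_def contents_def sizes_def)
  have x': "x \<in> {lo i j..hi i j}"
    using bucket_in_range(2)[OF _ x, of "K i"] i by (simp add: lo_def hi_def rowK_def j)
  have lay: "layout (sizes s) (contents s) (arr s)"
    and t: "num_items (contents s) = t" "card (dom (arr s)) = t"
    using tidy by (auto simp: tidy_def)
  have k: "i \<le> k" using i by simp
  show ?thesis
    unfolding tidy_def put_bucket_simps contents_put_bucket[OF k] arr_put_bucket[OF i]
    using layout_add_item[OF lay ij room x'] layout_add_item_card[OF lay ij room x' t]
      num_items_add_item[OF ij, of x "contents s"] t by simp
qed

lemma bins_put_previous:
  assumes "bins t i s" and i: "i \<in> {1..k}" and t: "t < n"
    and j': "j' = bucket (K (i - 1)) (xs ! t)" and free: "free_cells s (i - 1) j' > 0"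
  shows "bins (Suc t) i (put_bucket (i - 1) j' (xs ! t) s)"
proof -
  let ?s = "put_bucket (i - 1) j' (xs ! t) s"
  let ?W = "window_count xs (K (i - 1))"
  obtain a f C where
    a: "a \<le> t" and C: "V - 1 \<le> C" "C \<le> 2 * V + 3 * V / 10"
    and f: "\<forall>j\<in>{1..K (i - 1)}. real (f j) \<le> 3 * V / 20"
    and cap: "\<forall>j\<in>{1..K i}. \<bar>real (bucket_size s i j + f (2 * j - 1) + f (2 * j)) - C\<bar> \<le> 1"
    and fr: "\<forall>j\<in>{1..K (i - 1)}. free_cells s (i - 1) j = f j - ?W a t j"
    and len: "\<forall>j\<in>{1..K i}. length (items s i j)
        = (?W a t (2 * j - 1) - f (2 * j - 1)) + (?W a t (2 * j) - f (2 * j))"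
    using assms(1) unfolding bins_def Let_def by blast
  have j'_in: "j' \<in> {1..K (i - 1)}"
    unfolding j' by (intro bucket_in_range(1) xs_nth t) simp
  have W: "?W a (Suc t) j = ?W a t j + (if j = j' then 1 else 0)" for j
    using window_count_Suc[OF a, of xs "K (i - 1)" j] by (auto simp: j')
  \<comment> \<open>Bucket \<open>j'\<close> still has room, so the arrival keeps its truncated
    excess at 0 and costs one free cell.\<close>
  have lt: "?W a t j' < f j'" using fr j'_in free by auto
  have excess: "?W a (Suc t) j - f j = ?W a t j - f j" for j
    using lt unfolding W by auto
  show ?thesis
    unfolding bins_def Let_def
  proof (rule exI[of _ a], rule exI[of _ f], rule exI[of _ C], intro conjI)
    show "\<forall>j\<in>{1..K (i - 1)}. free_cells ?s (i - 1) j = f j - ?W a (Suc t) j"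
      using fr unfolding free_cells_put_bucket W by auto
    show "\<forall>j\<in>{1..K i}. length (items ?s i j)
        = (?W a (Suc t) (2 * j - 1) - f (2 * j - 1)) + (?W a (Suc t) (2 * j) - f (2 * j))"
      using len i unfolding excess by (auto simp: put_bucket_simps add_item_def)
  qed (use a C f cap in \<open>auto simp: put_bucket_simps\<close>)
qed

lemma bins_put_current:
  assumes "bins t i s" and i: "i \<in> {1..k}" and t: "t < n"
    and full: "free_cells s (i - 1) (bucket (K (i - 1)) (xs ! t)) = 0"
    and j: "j = bucket (K i) (xs ! t)"
  shows "bins (Suc t) i (put_bucket i j (xs ! t) s)"
proof -
  let ?s = "put_bucket i j (xs ! t) s"
  let ?W = "window_count xs (K (i - 1))"
  define j' where "j' = bucket (K (i - 1)) (xs ! t)"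
  obtain a f C where
    a: "a \<le> t" and C: "V - 1 \<le> C" "C \<le> 2 * V + 3 * V / 10"
    and f: "\<forall>j\<in>{1..K (i - 1)}. real (f j) \<le> 3 * V / 20"
    and cap: "\<forall>j\<in>{1..K i}. \<bar>real (bucket_size s i j + f (2 * j - 1) + f (2 * j)) - C\<bar> \<le> 1"
    and fr: "\<forall>j\<in>{1..K (i - 1)}. free_cells s (i - 1) j = f j - ?W a t j"
    and len: "\<forall>j\<in>{1..K i}. length (items s i j)
        = (?W a t (2 * j - 1) - f (2 * j - 1)) + (?W a t (2 * j) - f (2 * j))"
    using assms(1) unfolding bins_def Let_def by blast
  have j'_in: "j' \<in> {1..K (i - 1)}"
    unfolding j'_def by (intro bucket_in_range(1) xs_nth t) simp
  have W: "?W a (Suc t) m = ?W a t m + (if m = j' then 1 else 0)" for m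
    using window_count_Suc[OF a, of xs "K (i - 1)" m] by (auto simp: j'_def)
  \<comment> \<open>Bucket \<open>j'\<close> is exhausted, so the arrival raises its excess by
    exactly one; \<open>dbl\<close> locates this excess in bucket \<open>j\<close> of
    \<open>A\<^sub>i\<close>.\<close>
  have ge: "f j' \<le> ?W a t j'" using fr j'_in full by (auto simp: j'_def)
  have excess: "?W a (Suc t) m - f m = (?W a t m - f m) + (if m = j' then 1 else 0)" for m
    using ge unfolding W by auto
  have dbl: "m = j \<longleftrightarrow> j' = 2 * m - 1 \<or> j' = 2 * m" if "m \<in> {1..K i}" for m
    using bucket_double[OF K_pos[of i] xs_nth[OF t], of m] that i K_double[of i]
    by (auto simp: j j'_def)
  show ?thesis
    unfolding bins_def Let_def
  proof (rule exI[of _ a], rule exI[of _ f], rule exI[of _ C], intro conjI)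
    show "\<forall>j\<in>{1..K (i - 1)}. free_cells ?s (i - 1) j = f j - ?W a (Suc t) j"
      using fr ge i unfolding free_cells_put_bucket W by auto
    show "\<forall>m\<in>{1..K i}. length (items ?s i m)
        = (?W a (Suc t) (2 * m - 1) - f (2 * m - 1)) + (?W a (Suc t) (2 * m) - f (2 * m))"
    proof
      fix m assume m: "m \<in> {1..K i}"
      have "length (items ?s i m) = length (items s i m) + (if m = j then 1 else 0)"
        by (simp add: put_bucket_simps add_item_def)
      then show "length (items ?s i m)
        = (?W a (Suc t) (2 * m - 1) - f (2 * m - 1)) + (?W a (Suc t) (2 * m) - f (2 * m))"
        using len m dbl[OF m] unfolding excess by auto
    qed
  qed (use a C f cap in \<open>auto simp: put_bucket_simps\<close>)
qed

lemma phase_inv_put: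
  assumes inv: "phase_inv t i s" and t: "t < n"
    and cs: "(2 \<le> i \<and> b = i - 1 \<and> free_cells s (i - 1) (bucket (K (i - 1)) (xs ! t)) > 0) \<or>
      (b = i \<and> free_cells s (i - 1) (bucket (K (i - 1)) (xs ! t)) = 0 \<and>
       free_cells s i (bucket (K i) (xs ! t)) > 0)"
  shows "phase_inv (Suc t) i (put_bucket b (bucket (K b) (xs ! t)) (xs ! t) s)"
proof -
  have i: "i \<in> {1..k}" and tidy: "tidy t s" and bins: "bins t i s"
    using inv by (auto simp: phase_inv_def)
  have b: "b \<in> {1..k}" "b = i \<or> b = i - 1" using cs i by auto
  have "tidy (Suc t) (put_bucket b (bucket (K b) (xs ! t)) (xs ! t) s)"
    by (rule tidy_put_bucket[OF tidy b(1) xs_nth[OF t] refl]) (use cs in auto)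
  moreover have "bins (Suc t) i (put_bucket b (bucket (K b) (xs ! t)) (xs ! t) s)"
    using cs bins_put_previous[OF bins i t refl] bins_put_current[OF bins i t _ refl] by auto
  ultimately show ?thesis
    using inv b unfolding phase_inv_def rows_ok_def rows_full_def rows_empty_def put_bucket_simps
    by (auto simp: add_item_def)
qed

text \<open>This closes the induction over phases: the inherited cells are used up, and the new
  empty cells satisfy the bound that the next phase requires of its own \<open>f\<close>.\<close>

lemma phase_overflow:
  assumes inv: "phase_inv t i s" and t: "t < n"
    and over: "free_cells s i (bucket (K i) (xs ! t)) = 0"
  shows "rows_full i s" "\<And>j. j \<in> {1..K i} \<Longrightarrow> real (free_cells s i j) \<le> 3 * V / 20"
proof -
  have i: "i \<in> {1..k}" and tidy: "tidy t s" and bins: "bins t i s"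
    and rf: "rows_full (i - 1) s"
    using inv by (auto simp: phase_inv_def)
  have K2: "K (i - 1) = 2 * K i" using i by (intro K_double) auto
  let ?W = "window_count xs (2 * K i)"
  obtain a f C where
    a: "a \<le> t" and C: "V - 1 \<le> C" "C \<le> 2 * V + 3 * V / 10"
    and f: "\<forall>j\<in>{1..2 * K i}. real (f j) \<le> 3 * V / 20"
    and cap: "\<forall>j\<in>{1..K i}. \<bar>real (bucket_size s i j + f (2 * j - 1) + f (2 * j)) - C\<bar> \<le> 1"
    and fr: "\<forall>j\<in>{1..2 * K i}. free_cells s (i - 1) j = f j - ?W a t j"
    and len: "\<forall>j\<in>{1..K i}. length (items s i j)
        = (?W a t (2 * j - 1) - f (2 * j - 1)) + (?W a t (2 * j) - f (2 * j))"
    using bins unfolding bins_def Let_def K2 by blast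
  have lay: "layout (sizes s) (contents s) (arr s)" using tidy by (simp add: tidy_def)
  define j0 where "j0 = bucket (K i) (xs ! t)"
  have j0: "j0 \<in> {1..K i}" unfolding j0_def by (intro bucket_in_range(1) xs_nth t) simp
  have dbl: "window_count xs (K i) a t j = ?W a t (2 * j - 1) + ?W a t (2 * j)" if "j \<in> {1..K i}" for j
    using that t length_xs by (intro window_count_double set_xs) auto
  have T: "t - a = (\<Sum>j=1..K i. ?W a t (2 * j - 1) + ?W a t (2 * j))"
    using sum_window_count[OF K_pos[of i] set_xs a] t length_xs dbl by simp
  have len_le: "length (items s i j) \<le> bucket_size s i j" if "j \<in> {1..K i}" for j
    by (rule layout_length_le[OF lay i that])
  have bal: "\<And>j. j \<in> {1..2 * K i} \<Longrightarrow> f j \<le> ?W a t j"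
    "\<And>j. j \<in> {1..K i} \<Longrightarrow> real (bucket_size s i j -
       ((?W a t (2 * j - 1) - f (2 * j - 1)) + (?W a t (2 * j) - f (2 * j)))) \<le> 3 * V / 20"
  proof (atomize(full), intro allI conjI)
    have conc: "\<bar>real (?W a t (2 * j - 1) + ?W a t (2 * j)) - real (t - a) / real (K i)\<bar> \<le> V / 20"
      if "real (t - a) \<le> 3 * V * real (K i)" "j \<in> {1..K i}" for j
      using concentrated[of i j a t] that a t i unfolding dbl[OF that(2), symmetric] by simp
    have conc2: "\<bar>real (?W a t j) - real (t - a) / real (2 * K i)\<bar> \<le> V / 20"
      if "real (t - a) \<le> 3 * V * real (K i)" "j \<in> {1..2 * K i}" for j
    proof -
      \<comment> \<open>The finer level admits windows twice as long, so the same length bound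
        suffices. For \<open>i = 1\<close> this is level 0.\<close>
      have "0 \<le> V * real (K i)" using V_large by simp
      then have "real (t - a) \<le> 3 * V * real (K (i - 1))" using that unfolding K2 by simp
      moreover have "i - 1 \<le> k" using i by auto
      ultimately show ?thesis
        using concentrated[of "i - 1" j a t] that a t unfolding K2 by simp
    qed
    have over': "(?W a t (2 * j0 - 1) - f (2 * j0 - 1)) + (?W a t (2 * j0) - f (2 * j0))
        = bucket_size s i j0"
      using over len len_le[OF j0] j0 unfolding free_cells_def j0_def[symmetric] by auto
    have len': "(?W a t (2 * j - 1) - f (2 * j - 1)) + (?W a t (2 * j) - f (2 * j)) \<le> bucket_size s i j"
      if "j \<in> {1..K i}" for j
      using len_le[OF that] len that by simp
    note * = overflow_balance[OF V_large K_pos[of i] C bspec[OF f] bspec[OF cap] len' T conc conc2 j0 over']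
    show "j \<in> {1..2 * K i} \<longrightarrow> f j \<le> ?W a t j" for j
      using *(1) by blast
    show "j \<in> {1..K i} \<longrightarrow> real (bucket_size s i j -
       ((?W a t (2 * j - 1) - f (2 * j - 1)) + (?W a t (2 * j) - f (2 * j)))) \<le> 3 * V / 20" for j
      using *(2) by blast
  qed
  show "real (free_cells s i j) \<le> 3 * V / 20" if "j \<in> {1..K i}" for j
    using bal(2)[OF that] len that by (simp add: free_cells_def)
  show "rows_full i s"
    unfolding rows_full_def
  proof (intro ballI)
    fix i' j assume ij: "i' \<in> {1..<i}" "j \<in> {1..K i'}"
    show "length (items s i' j) = bucket_size s i' j"
    proof (cases "i' < i - 1")
      case True
      then show ?thesis using rf ij by (auto simp: rows_full_def)
    next
      case False
      then have i': "i' = i - 1" using ij by auto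
      then have j: "j \<in> {1..2 * K i}" using ij K2 by simp
      then have "free_cells s i' j = 0" using fr bal(1)[OF j] i' by simp
      moreover have "length (items s i' j) \<le> bucket_size s i' j"
        using ij i by (intro layout_length_le[OF lay]) auto
      ultimately show ?thesis by (simp add: free_cells_def)
    qed
  qed
qed

section \<open>Starting a phase\<close>

lemma split_bounds:
  assumes "m > 0"
  shows "j \<in> {1..m} \<Longrightarrow> \<bar>real (split h T m j) - real T / real m\<bar> \<le> 1"
    and "(\<Sum>j=1..m. split h T m j) = T"
proof -
  show "(\<Sum>j=1..m. split h T m j) = T"
    using split assms unfolding balanced_split_def by blast
  assume "j \<in> {1..m}"
  then have "int (split h T m j) \<in> {\<lfloor>real T / real m\<rfloor>, \<lfloor>real T / real m\<rfloor> + 1}"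
    using split assms unfolding balanced_split_def by blast
  then have "real_of_int (int (split h T m j)) = real_of_int \<lfloor>real T / real m\<rfloor> \<or>
      real_of_int (int (split h T m j)) = real_of_int \<lfloor>real T / real m\<rfloor> + 1"
    by auto
  then show "\<bar>real (split h T m j) - real T / real m\<bar> \<le> 1"
    using floor_correct[of "real T / real m"] by (simp only: of_int_of_nat_eq) linarith
qed

text \<open>New bucket sizes shift the blocks inside row \<open>i\<close> only, because rows start
  at fixed places; with no item in that row nothing moves.\<close>

lemma layout_resize:
  assumes lay: "layout sz it ar" and empty: "\<And>j. it i j = []"
    and g: "(\<Sum>j=1..rowK i. g j) \<le> rowlen i"
  shows "layout (sz(i := g)) it ar"
proof -
  have "pos (sz(i := g)) it a b r = pos sz it a b r" if "r < length (it a b)" for a b r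
    using that empty by (cases "a = i") (auto simp: pos_def start_def)
  moreover have "buckets_ok (sz(i := g)) it"
    using lay g empty unfolding layout_def buckets_ok_def by auto
  ultimately show ?thesis using lay unfolding layout_def by auto
qed

text \<open>Here the bound on empty cells pays off: two buckets have at most
  \<open>3 * V / 10\<close> of them, less than any bin capacity, which is at least
  \<open>V - 2\<close>. So no bucket size would become negative, and \<open>Stuck\<close> is never
  entered.\<close>

lemma start_phase_inv:
  assumes i: "1 \<le> i" "i < k" and tidy: "tidy t s" and B: "B_items s = []"
    and ok: "rows_ok i s" and full: "rows_full i s" and empty: "rows_empty i s"
    and free: "\<And>j. j \<in> {1..K i} \<Longrightarrow> real (free_cells s i j) \<le> 3 * V / 20"
  shows "phase_inv t (Suc i) (start_phase (Suc i) s)"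
proof -
  define N where "N = (\<Sum>j=1..K i. length (items s i j))"
  define T where "T = sub_len n i + sub_len n (Suc i) - N"
  define cap where "cap = split (seen s) T (K (Suc i))"
  define fr where "fr = (\<lambda>j. free_cells s i (2 * j - 1) + free_cells s i (2 * j))"
  define C where "C = real T / real (K (Suc i))"
  define s' where "s' = s\<lparr> mode := Phase (Suc i),
    bucket_size := (bucket_size s)(Suc i := \<lambda>j. cap j - fr j) \<rparr>"
  have K2: "K i = 2 * K (Suc i)" using K_double[of "Suc i"] i by simp
  have lay: "layout (sizes s) (contents s) (arr s)" using tidy by (simp add: tidy_def)
  have "(\<Sum>j=1..K i. free_cells s i j) + N = (\<Sum>j=1..K i. bucket_size s i j)"
    unfolding N_def sum.distrib[symmetric] free_cells_def
    using i layout_length_le[OF lay, of i] by (intro sum.cong) auto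
  also have "\<dots> = sub_len n i" using ok i by (auto simp: rows_ok_def)
  finally have T: "T = (\<Sum>j=1..K i. free_cells s i j) + sub_len n (Suc i)"
    by (simp add: T_def)
  have sum_fr: "(\<Sum>j=1..K (Suc i). fr j) = (\<Sum>j=1..K i. free_cells s i j)"
    unfolding fr_def K2 by (rule sum_pairs[symmetric])
  \<comment> \<open>\<open>A\<^sub>i\<close> has \<open>2 * K (Suc i)\<close> buckets with at most
    \<open>3 * V / 20\<close> empty cells each; this is the origin of \<open>3 * V / 10\<close> in
    the upper bound on \<open>C\<close>.\<close>
  have "real (\<Sum>j=1..K i. free_cells s i j) \<le> (\<Sum>j=1..K i. 3 * V / 20)"
    unfolding of_nat_sum using free by (intro sum_mono) auto
  then have fr_le: "real (\<Sum>j=1..K i. free_cells s i j) \<le> 3 * V / 10 * real (K (Suc i))"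
    by (simp add: K2)
  have Kp: "real (K (Suc i)) > 0" by simp
  have "real T = real (\<Sum>j=1..K i. free_cells s i j) + real (sub_len n (Suc i))"
    by (simp only: T of_nat_add)
  moreover have "Suc i \<in> {1..k}" using i by simp
  note sub_len_lower[OF this] sub_len_upper[OF this]
  ultimately have "(V - 1) * K (Suc i) \<le> T" "T \<le> (2 * V + 3 * V / 10) * K (Suc i)"
    using fr_le unfolding distrib_right by linarith+
  then have C: "V - 1 \<le> C" "C \<le> 2 * V + 3 * V / 10"
    unfolding C_def using Kp by (simp_all add: pos_le_divide_eq pos_divide_le_eq)
  have cap: "\<bar>real (cap j) - C\<bar> \<le> 1" if "j \<in> {1..K (Suc i)}" for j
    unfolding cap_def C_def by (rule split_bounds(1)[OF _ that]) simp
  have fr: "real (fr j) \<le> 3 * V / 10" if "j \<in> {1..K (Suc i)}" for j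
  proof -
    have "2 * j - 1 \<in> {1..K i}" "2 * j \<in> {1..K i}" using that by (auto simp: K2)
    from free[OF this(1)] free[OF this(2)] show ?thesis by (simp add: fr_def)
  qed
  have "real (fr j) \<le> real (cap j)" if "j \<in> {1..K (Suc i)}" for j
    using cap[OF that] fr[OF that] C V_large by linarith
  then have le: "fr j \<le> cap j" if "j \<in> {1..K (Suc i)}" for j
    using that by simp
  have s': "start_phase (Suc i) s = s'"
    using le by (simp add: start_phase_def Let_def s'_def cap_def T_def N_def fr_def)
  have size: "real (cap j - fr j) = real (cap j) - real (fr j)" if "j \<in> {1..K (Suc i)}" for j
    using le[OF that] by (simp add: of_nat_diff)
  have sum_size: "(\<Sum>j=1..K (Suc i). cap j - fr j) = sub_len n (Suc i)"
  proof -
    have "(\<Sum>j=1..K (Suc i). cap j - fr j) + (\<Sum>j=1..K (Suc i). fr j) = (\<Sum>j=1..K (Suc i). cap j)"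
      unfolding sum.distrib[symmetric] using le by (intro sum.cong) auto
    also have "\<dots> = T" unfolding cap_def by (rule split_bounds(2)) simp
    finally show ?thesis using T sum_fr by simp
  qed
  have "layout ((sizes s)(Suc i := \<lambda>j. cap j - fr j)) (contents s) (arr s)"
    using sum_size i empty
    by (intro layout_resize lay) (auto simp: contents_def rows_empty_def rowK_def rowlen_def)
  moreover have "sizes s' = (sizes s)(Suc i := \<lambda>j. cap j - fr j)" "contents s' = contents s"
    using i by (auto simp: s'_def sizes_def contents_def fun_eq_iff)
  ultimately have "tidy t s'"
    using tidy by (simp add: tidy_def s'_def)
  moreover have "rows_ok (Suc i) s'"
  proof -
    have "1 \<le> cap j - fr j \<and> real (cap j - fr j) \<le> 3 * V" if j: "j \<in> {1..K (Suc i)}" for j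
    proof -
      have "1 \<le> real (cap j - fr j)" "real (cap j - fr j) \<le> 3 * V"
        using size[OF j] cap[OF j] fr[OF j] C V_large by linarith+
      then show ?thesis by linarith
    qed
    then show ?thesis
      using ok sum_size by (auto simp: rows_ok_def s'_def le_Suc_eq)
  qed
  moreover have "rows_full i s'"
    using full by (auto simp: rows_full_def s'_def)
  moreover have "rows_empty (Suc i) s'"
    using empty by (auto simp: rows_empty_def s'_def)
  moreover have "bins t (Suc i) s'"
    unfolding bins_def Let_def
  \<comment> \<open>The window starting at \<open>t\<close> is still empty, so \<open>f\<close> is
    the present number of empty cells in \<open>A\<^sub>i\<close>.\<close>
  proof (rule exI[of _ t], rule exI[of _ "free_cells s i"], rule exI[of _ C], intro conjI)
    show "\<forall>j\<in>{1..K (Suc i)}. \<bar>real (bucket_size s' (Suc i) j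
        + free_cells s i (2 * j - 1) + free_cells s i (2 * j)) - C\<bar> \<le> 1"
    proof
      fix j assume j: "j \<in> {1..K (Suc i)}"
      have "bucket_size s' (Suc i) j + free_cells s i (2 * j - 1) + free_cells s i (2 * j) = cap j"
        using le[OF j] by (simp add: s'_def fr_def)
      then show "\<bar>real (bucket_size s' (Suc i) j
        + free_cells s i (2 * j - 1) + free_cells s i (2 * j)) - C\<bar> \<le> 1"
        using cap[OF j] by simp
    qed
  qed (use C free empty in \<open>auto simp: s'_def free_cells_def rows_empty_def\<close>)
  ultimately show ?thesis
    using i B unfolding s' phase_inv_def by (simp add: s'_def)
qed

lemma init_inv: "phase_inv 0 1 init"
proof -
  define C where "C = real (sub_len n 1) / real (K 1)"
  define cap where "cap = split [] (sub_len n 1) (K 1)"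
  have k: "1 \<in> {1..k}" using num_subs by simp
  have Kp: "real (K 1) > 0" by simp
  have C: "V - 1 \<le> C" "C \<le> 2 * V"
    unfolding C_def using sub_len_lower[OF k] sub_len_upper[OF k] Kp
    by (simp_all add: pos_le_divide_eq pos_divide_le_eq)
  have cap: "\<bar>real (cap j) - C\<bar> \<le> 1" if "j \<in> {1..K 1}" for j
    unfolding cap_def C_def by (rule split_bounds(1)[OF _ that]) simp
  have sum_cap: "(\<Sum>j=1..K 1. cap j) = sub_len n 1"
    unfolding cap_def by (rule split_bounds(2)) simp
  have init: "mode init = Phase 1" "bucket_size init = (\<lambda>_ _. 0)(1 := cap)"
    "items init = (\<lambda>_ _. [])" "B_items init = []" "arr init = Map.empty"
    by (auto simp: init_def cap_def)
  have "buckets_ok (sizes init) (contents init)"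
    unfolding buckets_ok_def using sum_cap
    by (auto simp: sizes_def contents_def init rowK_def rowlen_def)
  then have "tidy 0 init"
    by (simp add: tidy_def layout_def num_items_def contents_def init)
  moreover have "rows_ok 1 init"
  proof -
    have "1 \<le> cap j \<and> real (cap j) \<le> 3 * V" if "j \<in> {1..K 1}" for j
    proof -
      have "1 \<le> real (cap j)" "real (cap j) \<le> 3 * V"
        using cap[OF that] C V_large by linarith+
      then show ?thesis by linarith
    qed
    then show ?thesis using sum_cap by (auto simp: rows_ok_def init)
  qed
  moreover have "bins 0 1 init"
    unfolding bins_def Let_def
  proof (rule exI[of _ 0], rule exI[of _ "\<lambda>_. 0"], rule exI[of _ C])
  qed (use C cap V_large in \<open>auto simp: init free_cells_def\<close>)
  ultimately show ?thesis
    using k by (simp add: phase_inv_def init rows_full_def rows_empty_def)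
qed

section \<open>Propagation of the invariant along the run\<close>

definition inv :: "nat \<Rightarrow> state \<Rightarrow> bool" where
  "inv t s \<longleftrightarrow> (\<exists>i. phase_inv t i s) \<or> final_inv t s"

lemma put_B_inv:
  assumes inv: "final_inv t s" and x: "x \<in> {0<..1}" and room: "length (B_items s) < B_len n"
  shows "final_inv (Suc t) (put_B x s)"
proof -
  have lay: "layout (sizes s) (contents s) (arr s)"
    and t: "num_items (contents s) = t" "card (dom (arr s)) = t"
    using inv room by (auto simp: final_inv_def)
  have ij: "Suc k \<in> {1..Suc k}" "1 \<in> {1..rowK (Suc k)}" by (auto simp: rowK_def)
  have room': "length (contents s (Suc k) 1) < sizes s (Suc k) 1"
    using room by (simp add: contents_def sizes_def)
  have x': "x \<in> {lo (Suc k) 1..hi (Suc k) 1}"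
    using x by (simp add: lo_def hi_def rowK_def)
  have eq: "sizes (put_B x s) = sizes s"
    "contents (put_B x s) = add_item (Suc k) 1 x (contents s)"
    by (auto simp: put_B_def Let_def sizes_def contents_def add_item_def fun_eq_iff)
  have arr: "arr (put_B x s) = (arr s)(pos (sizes s) (add_item (Suc k) 1 x (contents s)) (Suc k) 1
      (length (contents s (Suc k) 1)) \<mapsto> x)"
    by (simp add: put_B_def Let_def pos_def start_def row_start_eq lo_def hi_def rowK_def
        sizes_def contents_def add_item_def atLeastLessThanSuc_atLeastAtMost)
  have keep: "mode (put_B x s) = mode s" "bucket_size (put_B x s) = bucket_size s"
    "items (put_B x s) = items s"
    by (auto simp: put_B_def Let_def)
  show ?thesis
    using inv layout_add_item[OF lay ij room' x'] layout_add_item_card[OF lay ij room' x' t]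
      num_items_add_item[OF ij, of x "contents s"] t
    unfolding final_inv_def rows_ok_def rows_full_def free_cells_def keep eq arr by simp
qed

lemma put_spill_inv:
  assumes inv: "final_inv t s" and x: "x \<in> {0<..1}" and t: "t < n"
    and full: "\<not> length (B_items s) < B_len n"
  shows "final_inv (Suc t) (put_spill x s)"
proof -
  have lay: "layout (sizes s) (contents s) (arr s)" and card: "card (dom (arr s)) = t"
    using inv by (auto simp: final_inv_def)
  have "buckets_ok (sizes s) (contents s)" using lay by (simp add: layout_def)
  then have "length (contents s (Suc k) 1) \<le> sizes s (Suc k) 1"
    unfolding buckets_ok_def by (auto simp: rowK_def)
  then have B: "length (B_items s) = B_len n"
    using full by (simp add: contents_def sizes_def)
  have "card (dom (arr s)) < n" "x \<in> {0..1}" using card t x by auto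
  note spilled = layout_spill[OF lay this, of "seen s"]
  have keep: "mode (put_spill x s) = mode s" "bucket_size (put_spill x s) = bucket_size s"
    "items (put_spill x s) = items s" "B_items (put_spill x s) = B_items s"
    "sizes (put_spill x s) = sizes s" "contents (put_spill x s) = contents s"
    "arr (put_spill x s) = (arr s)(spill (seen s) {p. p < n \<and> arr s p = None} \<mapsto> x)"
    by (auto simp: put_spill_def sizes_def contents_def fun_eq_iff)
  show ?thesis
    using inv spilled card B
    unfolding final_inv_def rows_ok_def rows_full_def free_cells_def keep by simp
qed

text \<open>The overflowing number has not been placed yet, so the time remains
  \<open>t\<close>.\<close>

lemma next_phase_inv:
  assumes inv: "phase_inv t i s" and t: "t < n"
    and over: "free_cells s i (bucket (K i) (xs ! t)) = 0"
  shows "inv t (next_phase i s)"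
proof -
  have i: "i \<in> {1..k}" and tidy: "tidy t s" and B: "B_items s = []"
    and ok: "rows_ok i s" and empty: "rows_empty i s"
    using inv by (auto simp: phase_inv_def)
  note over = phase_overflow[OF inv t over]
  show ?thesis
  proof (cases "i < k")
    case True
    then show ?thesis
      using start_phase_inv[OF _ True tidy B ok over(1) empty over(2)] i
      by (auto simp: inv_def next_phase_def)
  next
    case False
    then have "i = k" using i by simp
    moreover have "sizes (s\<lparr>mode := Final\<rparr>) = sizes s" "contents (s\<lparr>mode := Final\<rparr>) = contents s"
      by (auto simp: sizes_def contents_def fun_eq_iff)
    ultimately have "final_inv t (s\<lparr>mode := Final\<rparr>)"
      using ok over tidy
      by (auto simp: final_inv_def tidy_def rows_ok_def rows_full_def free_cells_def)
    then show ?thesis using False by (simp add: inv_def next_phase_def)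
  qed
qed

text \<open>The induction follows the recursion of \<open>place\<close>, which retries the same
  number after each change of phase.\<close>

lemma place_inv:
  assumes "inv t s" "t < n" "x = xs ! t"
  shows "inv (Suc t) (place x s)"
  using assms
proof (induction x s rule: place.induct)
  case (1 x s)
  have x: "x \<in> {0<..1}" using xs_nth[of t] 1 by simp
  from 1(2) show ?case unfolding inv_def[of t]
  proof (elim disjE exE)
    fix i assume inv: "phase_inv t i s"
    then have mode: "mode s = Phase i" by (simp add: phase_inv_def)
    let ?j' = "bucket (K (i - 1)) x" and ?j = "bucket (K i) x"
    \<comment> \<open>A free cell in the previous row already implies the test \<open>2 <= i\<close>
      of \<open>place\<close>, as row 0 has no cells.\<close>
    have row0: "free_cells s (i - 1) ?j' = 0" if "\<not> 2 \<le> i"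
      using inv that by (auto simp: phase_inv_def rows_empty_def free_cells_def)
    consider (prev) "2 \<le> i" "free_cells s (i - 1) ?j' > 0"
      | (cur) "free_cells s (i - 1) ?j' = 0" "free_cells s i ?j > 0"
      | (over) "free_cells s (i - 1) ?j' = 0" "free_cells s i ?j = 0"
      using row0 by (metis gr0I)
    then show ?thesis
    proof cases
      case prev
      then have "place x s = put_bucket (i - 1) ?j' x s"
        by (subst place.simps) (simp add: mode Let_def)
      then show ?thesis
        using phase_inv_put[OF inv 1(3), of "i - 1"] prev 1(4) by (auto simp: inv_def)
    next
      case cur
      then have "place x s = put_bucket i ?j x s"
        by (subst place.simps) (simp add: mode Let_def)
      then show ?thesis
        using phase_inv_put[OF inv 1(3), of i] cur 1(4) by (auto simp: inv_def)
    next
      case over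
      then have "place x s = place x (next_phase i s)"
        by (subst place.simps) (simp add: mode Let_def)
      moreover have "inv (Suc t) (place x (next_phase i s))"
        using over next_phase_inv[OF inv 1(3)] 1(3,4) by (intro 1(1)[OF mode refl refl]) auto
      ultimately show ?thesis by simp
    qed
  next
    assume inv: "final_inv t s"
    then have "mode s = Final" by (simp add: final_inv_def)
    then have "place x s = (if length (B_items s) < B_len n then put_B x s else put_spill x s)"
      by (subst place.simps) simp
    then show ?thesis
      using put_B_inv[OF inv x] put_spill_inv[OF inv x 1(3)] by (auto simp: inv_def)
  qed
qed

text \<open>\<open>seen\<close> affects only the choices made by \<open>split\<close> and
  \<open>spill\<close>, and the invariant is indifferent to them.\<close>

lemma inv_seen: "inv t (s\<lparr>seen := h\<rparr>) \<longleftrightarrow> inv t s"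
proof -
  have "sizes (s\<lparr>seen := h\<rparr>) = sizes s" "contents (s\<lparr>seen := h\<rparr>) = contents s"
    by (auto simp: sizes_def contents_def fun_eq_iff)
  then show ?thesis
    by (simp add: inv_def phase_inv_def final_inv_def tidy_def rows_ok_def rows_full_def
        rows_empty_def bins_def free_cells_def)
qed

lemma run_inv: "t \<le> n \<Longrightarrow> inv t (foldl step init (take t xs))"
proof (induction t)
  case 0
  then show ?case using init_inv by (auto simp: inv_def)
next
  case (Suc t)
  then show ?case
    using place_inv[of t _ "xs ! t"] length_xs
    by (simp add: take_Suc_conv_app_nth step_def inv_seen)
qed

text \<open>By counting: \<open>A\<^sub>1, ..., A\<^sub>k\<close> hold fewer than \<open>n\<close>
  numbers, so the final phase has been reached; and if \<open>B\<close> were not full, all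
  \<open>n\<close> numbers would be listed items, for which there is no room.\<close>

lemma end_inv:
  defines "s \<equiv> foldl step init xs"
  shows "final_inv n s" "length (B_items s) = B_len n" "dom (arr s) = {..<n}"
proof -
  have inv: "inv n s" using run_inv[of n] length_xs by (simp add: s_def)
  have bound: "num_items (contents s) \<le> (\<Sum>i=1..k. sub_len n i) + length (B_items s)"
    if lay: "layout (sizes s) (contents s) (arr s)"
  proof -
    have ok: "buckets_ok (sizes s) (contents s)" using lay by (simp add: layout_def)
    have "(\<Sum>j=1..rowK i. length (contents s i j)) \<le> sub_len n i" if "i \<in> {1..k}" for i
    proof -
      have "(\<Sum>j=1..rowK i. length (contents s i j)) \<le> (\<Sum>j=1..rowK i. sizes s i j)"
        using ok that by (intro sum_mono) (auto simp: buckets_ok_def)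
      also have "\<dots> \<le> rowlen i" using ok that by (auto simp: buckets_ok_def)
      finally show ?thesis using that by (simp add: rowlen_def)
    qed
    then have "(\<Sum>i=1..k. \<Sum>j=1..rowK i. length (contents s i j)) \<le> (\<Sum>i=1..k. sub_len n i)"
      by (intro sum_mono) auto
    then show ?thesis
      by (simp add: num_items_def rowK_def contents_def)
  qed
  have "\<not> phase_inv n i s" for i
  proof
    assume "phase_inv n i s"
    then have "layout (sizes s) (contents s) (arr s)" "num_items (contents s) = n" "B_items s = []"
      by (auto simp: phase_inv_def tidy_def)
    then show False using bound total_len by simp
  qed
  then show final: "final_inv n s" using inv by (auto simp: inv_def)
  then have lay: "layout (sizes s) (contents s) (arr s)" by (simp add: final_inv_def)
  then have "buckets_ok (sizes s) (contents s)" by (simp add: layout_def)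
  then have "length (contents s (Suc k) 1) \<le> sizes s (Suc k) 1"
    unfolding buckets_ok_def by (auto simp: rowK_def)
  then have "length (B_items s) \<le> B_len n" by (simp add: contents_def sizes_def)
  moreover have "n - (\<Sum>i=1..k. sub_len n i) \<le> length (B_items s)"
    if "num_items (contents s) = n"
    using bound[OF lay] that by simp
  ultimately show "length (B_items s) = B_len n"
    using final by (auto simp: final_inv_def B_len_def)
  show "dom (arr s) = {..<n}"
    using final by (intro card_subset_eq) (auto simp: final_inv_def layout_def)
qed

end

section \<open>The cost of a run\<close>

locale phased_run_cost = phased_run +
  fixes c :: real
  assumes c_nonneg: "c \<ge> 0"
    and adv_cost: "\<And>m a b ys A. a < b \<Longrightarrow> length ys = m \<Longrightarrow> set ys \<subseteq> {a..b} \<Longrightarrow>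
      (\<And>t. t < m \<Longrightarrow> A (adv m a b (take (Suc t) ys)) = ys ! t) \<Longrightarrow>
      array_cost m A \<le> c * sqrt (real m) * (b - a)"
    and B_len_upper: "real (B_len n) \<le> 100 * V"
    and last_num_buckets: "K k \<le> 100"
begin

definition last_state :: state where
  "last_state = foldl step init xs"

definition cell :: "nat \<Rightarrow> real" where
  "cell p = the (arr last_state p)"

abbreviation "S \<equiv> sizes last_state"
abbreviation "I \<equiv> contents last_state"

lemma last_layout: "layout S I (arr last_state)"
  using end_inv(1) by (simp add: final_inv_def last_state_def)

lemma last_buckets_ok: "buckets_ok S I"
  using last_layout by (simp add: layout_def)

lemma cell_unit: "p < n \<Longrightarrow> cell p \<in> {0..1}"
proof -
  assume "p < n"
  then have "p \<in> dom (arr last_state)" using end_inv(3) by (simp add: last_state_def)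
  then have "cell p \<in> ran (arr last_state)" by (auto simp: cell_def ran_def)
  then show ?thesis using last_layout by (auto simp: layout_def)
qed

lemma cell_bucket:
  assumes "i \<in> {1..Suc k}" "j \<in> {1..rowK i}" "r < length (I i j)"
  shows "cell (start S i j + adv (S i j) (lo i j) (hi i j) (take (Suc r) (I i j))) = I i j ! r"
proof -
  have "arr last_state (pos S I i j r) = Some (I i j ! r)"
    using last_layout assms unfolding layout_def by blast
  then show ?thesis by (simp add: cell_def pos_def)
qed

text \<open>A bucket covers an interval of length \<open>1 / rowK i\<close>, so all buckets together
  cost only \<open>c * sqrt M\<close>. Cells missing from the lists cost at most 2 each, and each
  seam \<open>d\<close>.\<close>

lemma row_cost:
  assumes i: "i \<in> {1..Suc k}"
    and total: "(\<Sum>j=1..rowK i. S i j) = rowlen i"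
    and size: "\<And>j. j \<in> {1..rowK i} \<Longrightarrow> S i j > 0 \<and> real (S i j) \<le> M"
    and free: "\<And>j. j \<in> {1..rowK i} \<Longrightarrow> real (S i j - length (I i j)) \<le> \<phi>"
    and jump: "\<And>j. j \<in> {1..rowK i} \<Longrightarrow> j < rowK i \<Longrightarrow>
      \<bar>cell (start S i (Suc j)) - cell (start S i (Suc j) - 1)\<bar> \<le> d"
    and d: "d \<ge> 0"
  shows "array_cost (rowlen i) (\<lambda>q. cell (row_start i + q))
       \<le> c * sqrt M + real (rowK i) * (2 * \<phi> + d)"
proof -
  have Kp: "real (rowK i) > 0" by simp
  have "array_cost (\<Sum>j=1..rowK i. S i j) (\<lambda>q. cell (row_start i + q))
      \<le> (\<Sum>j=1..rowK i. c * sqrt M / rowK i + 2 * \<phi>) + real (rowK i) * d"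
  proof (rule array_cost_blocks)
    fix j assume j: "j \<in> {1..rowK i}"
    show "0 < S i j" using size[OF j] by simp
    have Ij: "length (I i j) \<le> S i j" "set (I i j) \<subseteq> {lo i j..hi i j}"
      using last_buckets_ok i j by (auto simp: buckets_ok_def)
    have "array_cost (S i j) (\<lambda>q. cell (start S i j + q))
        \<le> c * sqrt (S i j) * (hi i j - lo i j) + 2 * real (S i j - length (I i j))"
    proof (rule partial_bucket_cost[OF adv adv_cost lo_less_hi _ _ Ij])
      show "0 \<le> lo i j" "hi i j \<le> 1" using bucket_bounds[OF j] by auto
      show "cell (start S i j + adv (S i j) (lo i j) (hi i j) (take (Suc t) (I i j))) = I i j ! t"
        if "t < length (I i j)" for t
        by (rule cell_bucket[OF i j that])
      show "cell (start S i j + q) \<in> {0..1}" if "q < S i j" for q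
        using block_le_n[OF last_buckets_ok i j] that by (intro cell_unit) auto
    qed auto
    also have "hi i j - lo i j = 1 / rowK i" by (simp add: hi_def lo_def field_simps)
    also have "c * sqrt (S i j) * (1 / rowK i) \<le> c * sqrt M * (1 / rowK i)"
      using size[OF j] c_nonneg by (intro mult_right_mono mult_left_mono) auto
    finally show "array_cost (S i j) (\<lambda>q. cell (row_start i + ((\<Sum>j'=1..<j. S i j') + q)))
        \<le> c * sqrt M / rowK i + 2 * \<phi>"
      using free[OF j] by (simp add: start_def add.assoc)
  next
    fix j assume j: "j \<in> {1..rowK i}" "j < rowK i"
    \<comment> \<open>Positivity lets the truncated \<open>- 1\<close> be moved past
      \<open>row_start i\<close>.\<close>
    have "0 < (\<Sum>j'=1..<Suc j. S i j')"
      using size[OF j(1)] j(1) by simp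
    then have "row_start i + ((\<Sum>j'=1..<Suc j. S i j') - 1) = start S i (Suc j) - 1"
      unfolding start_def by simp
    then show "\<bar>cell (row_start i + (\<Sum>j'=1..<Suc j. S i j')) -
        cell (row_start i + ((\<Sum>j'=1..<Suc j. S i j') - 1))\<bar> \<le> d"
      using jump[OF j] by (simp only: start_def)
  qed (rule d)
  also have "(\<Sum>j=1..rowK i. c * sqrt M / rowK i + 2 * \<phi>) = c * sqrt M + rowK i * (2 * \<phi>)"
    using Kp by (simp add: distrib_left)
  finally show ?thesis unfolding total by (simp add: distrib_left)
qed

lemma block_end_less_n:
  assumes "i \<in> {1..Suc k}" "j \<in> {1..rowK i}" "j < rowK i" "S i (Suc j) > 0"
  shows "start S i (Suc j) < n"
  using block_le_n[OF last_buckets_ok assms(1), of "Suc j"] assms by auto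

text \<open>With no foreign numbers in the row, the two cells at a seam hold values from adjacent
  intervals of length \<open>1 / rowK i\<close>. The seams of a full row thus cost at most 2 in
  total.\<close>

lemma jump_full_row:
  assumes i: "i \<in> {1..Suc k}" and j: "j \<in> {1..rowK i}" "j < rowK i"
    and full: "\<And>j. j \<in> {1..rowK i} \<Longrightarrow> S i j > 0 \<and> length (I i j) = S i j"
  shows "\<bar>cell (start S i (Suc j)) - cell (start S i (Suc j) - 1)\<bar> \<le> 2 / rowK i"
proof -
  have range: "cell (start S i m + q) \<in> {lo i m..hi i m}" if m: "m \<in> {1..rowK i}" and q: "q < S i m" for m q
  proof -
    have "set (I i m) \<subseteq> {lo i m..hi i m}" "length (I i m) = S i m"
      using last_buckets_ok i m full[OF m] by (auto simp: buckets_ok_def)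
    then show ?thesis
      using cell_bucket[OF i m] q
      by (intro online_sorting_full_range[OF adv lo_less_hi, where A = "\<lambda>q. cell (start S i m + q)"]) auto
  qed
  have j': "Suc j \<in> {1..rowK i}" using j by auto
  have "start S i (Suc j) = start S i j + S i j" using j by (simp add: start_def)
  then have "start S i (Suc j) - 1 = start S i j + (S i j - 1)"
    using full[OF j(1)] by auto
  moreover have "cell (start S i j + (S i j - 1)) \<in> {lo i j..hi i j}"
    using full[OF j(1)] by (intro range j) auto
  moreover have "cell (start S i (Suc j) + 0) \<in> {lo i (Suc j)..hi i (Suc j)}"
    using full[OF j'] by (intro range j') auto
  moreover have "lo i j = hi i j - 1 / rowK i" "lo i (Suc j) = hi i j"
    "hi i (Suc j) = hi i j + 1 / rowK i"
    by (auto simp: lo_def hi_def add_divide_distrib diff_divide_distrib)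
  moreover have "2 / real (rowK i) = 1 / rowK i + 1 / rowK i" by simp
  ultimately show ?thesis by auto
qed

lemma last_rows:
  assumes "i \<in> {1..k}"
  shows "(\<Sum>j=1..rowK i. S i j) = rowlen i"
    and "\<And>j. j \<in> {1..rowK i} \<Longrightarrow> S i j > 0 \<and> real (S i j) \<le> 3 * V"
    and "\<And>j. i < k \<Longrightarrow> j \<in> {1..rowK i} \<Longrightarrow> length (I i j) = S i j"
    and "\<And>j. i = k \<Longrightarrow> j \<in> {1..rowK i} \<Longrightarrow> real (S i j - length (I i j)) \<le> 3 * V / 20"
  using end_inv(1) assms
  unfolding final_inv_def rows_ok_def rows_full_def free_cells_def last_state_def[symmetric]
  by (auto simp: sizes_def contents_def rowK_def rowlen_def Suc_le_eq)

lemma total_cost_bound: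
  "total_cost xs \<le> real (Suc k) * (10 * c * sqrt V + 3) + 30 * V + 100"
proof -
  \<comment> \<open>A common bound for all rows: \<open>10 * c * sqrt V\<close> covers buckets of up
    to \<open>100 * V\<close> cells, the case of \<open>B\<close>; 2 covers the seams of a full row;
    the extra term concerns \<open>A\<^sub>k\<close> alone.\<close>
  let ?b = "\<lambda>i. 10 * c * sqrt V + 2 + (if i = k then 30 * V + 100 else 0)"
  have sqrtM: "c * sqrt M \<le> 10 * c * sqrt V" if "M \<le> 100 * V" for M
  proof -
    have "sqrt M \<le> sqrt (100 * V)" using that by simp
    also have "\<dots> = 10 * sqrt V" by (simp add: real_sqrt_mult)
    finally show ?thesis using mult_left_mono[OF _ c_nonneg] by fastforce
  qed
  have "array_cost (\<Sum>i=1..Suc k. rowlen i) cell \<le> (\<Sum>i=1..Suc k. ?b i) + real (Suc k) * 1"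
  proof (rule array_cost_blocks)
    fix i assume i: "i \<in> {1..Suc k}"
    show "0 < rowlen i"
    proof (cases "i \<le> k")
      case True
      have "0 < (V - 1) * K i" using V_large by simp
      also have "\<dots> \<le> sub_len n i" using i True by (intro sub_len_lower) auto
      finally show ?thesis using True by (simp add: rowlen_def)
    qed (use total_len in \<open>auto simp: rowlen_def B_len_def\<close>)
    have "array_cost (rowlen i) (\<lambda>q. cell (row_start i + q)) \<le> ?b i"
    proof -
      consider "i < k" | "i = k" | "i = Suc k" using i by force
      then show ?thesis
      proof cases
        case 1
        then have ik: "i \<in> {1..k}" using i by simp
        have "array_cost (rowlen i) (\<lambda>q. cell (row_start i + q))
            \<le> c * sqrt (3 * V) + real (rowK i) * (2 * 0 + 2 / rowK i)"
        proof (rule row_cost[OF i last_rows(1,2)[OF ik]])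
          show "real (S i j - length (I i j)) \<le> 0" if "j \<in> {1..rowK i}" for j
            using last_rows(3)[OF ik 1 that] by simp
          show "\<bar>cell (start S i (Suc j)) - cell (start S i (Suc j) - 1)\<bar> \<le> 2 / rowK i"
            if "j \<in> {1..rowK i}" "j < rowK i" for j
            using last_rows(2,3)[OF ik] 1 by (intro jump_full_row[OF i that]) auto
        qed auto
        also have "real (rowK i) * (2 * 0 + 2 / rowK i) = 2"
          using rowK_pos[of i] by (simp del: rowK_pos)
        finally show ?thesis using sqrtM[of "3 * V"] V_large 1 by simp
      next
        case 2
        then have ik: "i \<in> {1..k}" using i by simp
        have "array_cost (rowlen i) (\<lambda>q. cell (row_start i + q))
            \<le> c * sqrt (3 * V) + real (rowK i) * (2 * (3 * V / 20) + 1)"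
        proof (rule row_cost[OF i last_rows(1,2)[OF ik] last_rows(4)[OF ik 2]])
          \<comment> \<open>Cells of \<open>A\<^sub>k\<close> may hold spilled numbers, so only the
            trivial bound 1 is available at a seam.\<close>
          show "\<bar>cell (start S i (Suc j)) - cell (start S i (Suc j) - 1)\<bar> \<le> 1"
            if j: "j \<in> {1..rowK i}" "j < rowK i" for j
          proof -
            have "start S i (Suc j) < n"
              using j last_rows(2)[OF ik, of "Suc j"] by (intro block_end_less_n[OF i]) auto
            then have "cell (start S i (Suc j)) \<in> {0..1}" "cell (start S i (Suc j) - 1) \<in> {0..1}"
              using cell_unit less_imp_diff_less by blast+
            then show ?thesis by auto
          qed
        qed auto
        \<comment> \<open>At most 100 buckets with at most \<open>3 * V / 20\<close> unlisted cells
          each; the total is \<open>30 * V + 100\<close>.\<close>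
        also have "real (rowK i) * (2 * (3 * V / 20) + 1) \<le> 100 * (2 * (3 * V / 20) + 1)"
          using last_num_buckets 2 V_large by (intro mult_right_mono) (auto simp: rowK_def)
        finally show ?thesis using sqrtM[of "3 * V"] V_large 2 by simp
      next
        case 3
        have B: "S i j = B_len n" "length (I i j) = B_len n" if "j \<in> {1..rowK i}" for j
          using that 3 end_inv(2) by (auto simp: sizes_def contents_def rowK_def last_state_def)
        have "array_cost (rowlen i) (\<lambda>q. cell (row_start i + q))
            \<le> c * sqrt (100 * V) + real (rowK i) * (2 * 0 + 1)"
          using 3 B B_len_upper total_len
          by (intro row_cost[OF i]) (auto simp: rowK_def rowlen_def B_len_def)
        then show ?thesis using sqrtM[of "100 * V"] 3 by (simp add: rowK_def)
      qed
    qed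
    then show "array_cost (rowlen i) (\<lambda>q. cell ((\<Sum>i'=1..<i. rowlen i') + q)) \<le> ?b i"
      by (simp only: row_start_def)
  next
    fix i assume i: "i \<in> {1..Suc k}" "i < Suc k"
    have "(\<Sum>i'=1..<Suc i. rowlen i') \<le> row_start (Suc k)"
      unfolding row_start_def using i by (intro sum_mono2) auto
    also have "\<dots> < n"
      using total_len by (simp add: row_start_eq atLeastLessThanSuc_atLeastAtMost)
    finally have "cell (\<Sum>i'=1..<Suc i. rowlen i') \<in> {0..1}"
      "cell ((\<Sum>i'=1..<Suc i. rowlen i') - 1) \<in> {0..1}"
      using cell_unit less_imp_diff_less by blast+
    then show "\<bar>cell (\<Sum>i'=1..<Suc i. rowlen i') - cell ((\<Sum>i'=1..<Suc i. rowlen i') - 1)\<bar> \<le> 1"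
      by auto
  qed simp
  also have "(\<Sum>i=1..Suc k. rowlen i) = n"
    using row_start_end by (simp add: row_start_def atLeastLessThanSuc_atLeastAtMost)
  also have "(\<Sum>i=1..Suc k. ?b i) = real (Suc k) * (10 * c * sqrt V + 2) + (30 * V + 100)"
    using num_subs by (simp add: sum.distrib)
  finally show ?thesis
    by (simp add: total_cost_def cell_def last_state_def distrib_left array_cost_def)
qed

end

section \<open>Parameters\<close>

lemma div_pow2_bounds:
  fixes n i :: nat
  shows "real (n div 2 ^ i) \<le> real n / 2 ^ i" "real n / 2 ^ i - 1 \<le> real (n div 2 ^ i)"
proof -
  have "\<lfloor>real n / real (2 ^ i)\<rfloor> = int (n div 2 ^ i)" by (rule floor_divide_of_nat_eq)
  then show "real (n div 2 ^ i) \<le> real n / 2 ^ i" "real n / 2 ^ i - 1 \<le> real (n div 2 ^ i)"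
    using floor_correct[of "real n / 2 ^ i"] by (simp_all del: of_nat_div)
qed

text \<open>A geometric sum; each of the \<open>k\<close> floors loses at most 1.\<close>

lemma sum_div_pow2_bounds:
  fixes n k :: nat
  shows "real (\<Sum>i=1..k. n div 2 ^ i) \<le> real n - real n / 2 ^ k"
    and "real n - real n / 2 ^ k - real k \<le> real (\<Sum>i=1..k. n div 2 ^ i)"
proof -
  have geo: "(\<Sum>i=1..k. real n / 2 ^ i) = real n - real n / 2 ^ k"
    by (induction k) (auto simp: field_simps)
  have "real (\<Sum>i=1..k. n div 2 ^ i) \<le> (\<Sum>i=1..k. real n / 2 ^ i)"
    unfolding of_nat_sum by (intro sum_mono div_pow2_bounds)
  then show "real (\<Sum>i=1..k. n div 2 ^ i) \<le> real n - real n / 2 ^ k" using geo by simp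
  have "(\<Sum>i=1..k. real n / 2 ^ i - 1) \<le> real (\<Sum>i=1..k. n div 2 ^ i)"
    unfolding of_nat_sum by (intro sum_mono div_pow2_bounds)
  then show "real n - real n / 2 ^ k - real k \<le> real (\<Sum>i=1..k. n div 2 ^ i)"
    using geo by (simp add: sum_subtractf)
qed

text \<open>This gives meaning to the definite description in \<open>ell\<close>, with
  \<open>X = n / (2 * V)\<close>.\<close>

lemma dyadic_scale_exists:
  fixes X :: real
  assumes "X \<ge> 2"
  shows "\<exists>!l::nat. l > 0 \<and> X / 2 < 2 ^ l \<and> 2 ^ l \<le> X"
proof (rule ex_ex1I)
  define l where "l = nat \<lfloor>log 2 X\<rfloor>"
  have log: "log 2 X \<ge> 1" using assms by simp
  then have l: "real l = real_of_int \<lfloor>log 2 X\<rfloor>" by (simp add: l_def)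
  have "real l \<le> log 2 X" "log 2 X < real l + 1" using l by linarith+
  moreover have "log 2 (2 ^ l) = real l" "log 2 (2 * 2 ^ l) = real l + 1"
    by (simp_all add: log_mult)
  ultimately have "log 2 (2 ^ l) \<le> log 2 X" "log 2 X < log 2 (2 * 2 ^ l)" by linarith+
  then have "2 ^ l \<le> X" "X < 2 * 2 ^ l"
    using assms by (subst (asm) log_le_cancel_iff log_less_cancel_iff; simp)+
  moreover have "l > 0" using log l by (simp add: l_def le_nat_iff)
  ultimately show "\<exists>l::nat. l > 0 \<and> X / 2 < 2 ^ l \<and> 2 ^ l \<le> X" by (intro exI[of _ l]) auto
next
  have no_less: "\<not> l < l'" if "X / 2 < 2 ^ l" "2 ^ l' \<le> X" for l l' :: nat
  proof
    assume "l < l'"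
    then have "(2::real) ^ Suc l \<le> 2 ^ l'" by (intro power_increasing) auto
    then show False using that by simp
  qed
  fix l l' :: nat
  assume "l > 0 \<and> X / 2 < 2 ^ l \<and> 2 ^ l \<le> X" "l' > 0 \<and> X / 2 < 2 ^ l' \<and> 2 ^ l' \<le> X"
  then show "l = l'" using no_less[of l l'] no_less[of l' l] by force
qed

lemma scale_parameters:
  fixes n :: nat and L V :: real
  defines "L \<equiv> log 2 (real n)"
  defines "V \<equiv> L\<^sup>2"
  assumes L: "L \<ge> 10" and nV: "real n \<ge> 100 * V"
  shows "1 \<le> num_subs n" "num_subs n \<le> ell n" "real (num_subs n) \<le> L"
    and "(\<Sum>i=1..num_subs n. sub_len n i) < n"
    and "\<And>i. i \<in> {1..num_subs n} \<Longrightarrow> (V - 1) * num_buckets n i \<le> sub_len n i"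
    and "\<And>i. i \<in> {1..num_subs n} \<Longrightarrow> sub_len n i \<le> 2 * V * num_buckets n i"
    and "real (B_len n) \<le> 100 * V" "num_buckets n (num_subs n) \<le> 100"
    and "num_buckets n i \<le> n"
proof -
  have "L * L \<ge> 10 * 10" using L by (intro mult_mono) auto
  then have V: "V \<ge> 100" by (simp add: V_def power2_eq_square)
  have LV: "L \<le> V" using L mult_right_mono[of 1 L L] by (simp add: V_def power2_eq_square)
  have n0: "real n > 0" using nV V by linarith
  define X where "X = real n / (2 * V)"
  have X: "X \<ge> 2" using nV V by (simp add: X_def field_simps)
  have "X / 2 = real n / (4 * V)" by (simp add: X_def)
  then have "\<exists>!l. l > 0 \<and> real n / (4 * V) < 2 ^ l \<and> 2 ^ l \<le> real n / (2 * V)"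
    using dyadic_scale_exists[OF X] unfolding X_def by simp
  from theI'[OF this]
  have ell: "ell n > 0" "real n / (4 * V) < 2 ^ ell n" "2 ^ ell n \<le> real n / (2 * V)"
    unfolding ell_def V_def L_def by blast+
  \<comment> \<open>\<open>C\<close> is the mean bucket size before rounding, the same at every
    level: \<open>n / 2^i = C * num_buckets n i\<close>. The inequalities defining
    \<open>ell\<close> place it between \<open>V\<close> and \<open>2 * V\<close>.\<close>
  define C where "C = real n / 2 ^ Suc (ell n)"
  have C: "V \<le> C" "C \<le> 2 * V"
    using ell V by (simp_all add: C_def field_simps)
  have pow_le: "2 ^ Suc (ell n) \<le> real n"
  proof -
    have "2 * 2 ^ ell n \<le> real n / V" using ell(3) V by (simp add: field_simps)
    also have "\<dots> \<le> real n" using V n0 by (simp add: divide_le_eq)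
    finally show ?thesis by simp
  qed
  have ell_L: "real (ell n) \<le> L"
  proof -
    have "2 ^ ell n \<le> real n" 
      using pow_le zero_le_power[of "2::real" "ell n"] unfolding power_Suc by linarith
    then have "log 2 (2 ^ ell n) \<le> log 2 (real n)" using n0 by (subst log_le_cancel_iff) simp_all
    then show ?thesis by (simp add: L_def)
  qed
  \<comment> \<open>\<open>R k\<close> cells remain after \<open>k\<close> subarrays; this exceeds
    \<open>n / 2^k\<close> by at most \<open>k\<close>, the total loss from floors.\<close>
  define R where "R = (\<lambda>k. real (n - (\<Sum>i=1..k. sub_len n i)))"
  have sum_le: "(\<Sum>i=1..k. sub_len n i) \<le> n" for k
  proof -
    have "real (\<Sum>i=1..k. n div 2 ^ i) \<le> real n"
      using sum_div_pow2_bounds(1)[of n k] n0 by (smt (verit) divide_nonneg_nonneg zero_le_power)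
    then show ?thesis by (simp only: sub_len_def of_nat_le_iff)
  qed
  have R: "real n / 2 ^ k \<le> R k" "R k \<le> real n / 2 ^ k + real k" for k
    using sum_div_pow2_bounds[of n k] sum_le[of k] unfolding R_def sub_len_def
    by (simp_all only: of_nat_diff)
  have num_subs: "num_subs n = (LEAST k. R k < 100 * V)"
    by (simp add: num_subs_def R_def V_def L_def)
  \<comment> \<open>After \<open>ell n\<close> subarrays fewer than
    \<open>4 * V + L <= 5 * V\<close> cells remain, so the least index exists and is at most
    \<open>ell n\<close>.\<close>
  have "R (ell n) < 100 * V"
  proof -
    have "real n / 2 ^ ell n < 4 * V" using ell(2) V by (simp add: field_simps)
    then show ?thesis using R(2)[of "ell n"] ell_L LV V by linarith
  qed
  then have k_ell: "num_subs n \<le> ell n" and Rk: "R (num_subs n) < 100 * V"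
    unfolding num_subs by (auto intro: Least_le LeastI)
  show "num_subs n \<le> ell n" by (rule k_ell)
  show "real (num_subs n) \<le> L" using k_ell ell_L by linarith
  have "\<not> R 0 < 100 * V" using nV by (simp add: R_def)
  then show "1 \<le> num_subs n" using Rk by (cases "num_subs n") auto
  have "0 < real n / 2 ^ num_subs n" using n0 by simp
  then have "0 < R (num_subs n)" using R(1)[of "num_subs n"] by linarith
  then show "(\<Sum>i=1..num_subs n. sub_len n i) < n" by (simp add: R_def)
  show "real (B_len n) \<le> 100 * V" using Rk by (simp add: B_len_def R_def)
  have CK: "real n / 2 ^ i = C * num_buckets n i" if "i \<le> num_subs n" for i
  proof -
    have "(2::real) ^ Suc (ell n) = 2 ^ i * 2 ^ (ell n + 1 - i)"
      using that k_ell by (simp flip: power_add)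
    then show ?thesis by (simp add: C_def num_buckets_def)
  qed
  have K1: "1 \<le> real (num_buckets n i)" for i by (simp add: num_buckets_def)
  show "(V - 1) * num_buckets n i \<le> sub_len n i" if "i \<in> {1..num_subs n}" for i
  proof -
    have "V * num_buckets n i \<le> real n / 2 ^ i"
      using CK[of i] that C by (simp add: mult_right_mono)
    moreover have "real n / 2 ^ i - 1 \<le> real (sub_len n i)"
      using div_pow2_bounds(2)[of n i] by (simp add: sub_len_def)
    \<comment> \<open>The floor loses at most 1, that is at most one cell per bucket.\<close>
    ultimately show ?thesis using K1[of i] by (simp add: left_diff_distrib)
  qed
  show "sub_len n i \<le> 2 * V * num_buckets n i" if "i \<in> {1..num_subs n}" for i
  proof -
    have "real (sub_len n i) \<le> real n / 2 ^ i"
      using div_pow2_bounds(1)[of n i] by (simp add: sub_len_def)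
    also have "\<dots> \<le> 2 * V * num_buckets n i"
      using CK[of i] that C by (simp add: mult_right_mono)
    finally show ?thesis .
  qed
  show "num_buckets n (num_subs n) \<le> 100"
  proof -
    \<comment> \<open>After \<open>A\<^sub>k\<close> at least \<open>n / 2^k\<close> cells remain,
      which is \<open>C\<close> times its number of buckets, but fewer than \<open>100 * V\<close>
      do; now \<open>C >= V\<close>.\<close>
    have "V * num_buckets n (num_subs n) \<le> C * num_buckets n (num_subs n)"
      using C by (intro mult_right_mono) auto
    also have "\<dots> < V * 100" using CK[of "num_subs n"] R(1)[of "num_subs n"] Rk by simp
    finally have "real (num_buckets n (num_subs n)) < 100" using V by simp
    then show ?thesis by simp
  qed
  have "num_buckets n i \<le> 2 ^ Suc (ell n)"
    unfolding num_buckets_def by (intro power_increasing) auto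
  then have "real (num_buckets n i) \<le> 2 ^ Suc (ell n)"
    by (metis of_nat_le_iff of_nat_numeral of_nat_power)
  then show "num_buckets n i \<le> n" using pow_le by linarith
qed

theorem theorem2:
  fixes adv :: placement_rule
  assumes "online_sorting_algorithm adv"
    and "adversarial_cost_sqrt adv"
  shows "\<exists>D :: real. \<exists>N :: nat. \<forall>n \<ge> N. \<forall>split spill.
    balanced_split split \<longrightarrow> chooses_member spill \<longrightarrow>
    (\<exists>E \<in> sets (iid_uniform n).
      measure (iid_uniform n) E \<ge> 1 - 1 / real n \<and>
      (\<forall>x \<in> E. phased_sorting.total_cost n adv split spill (map x [0..<n])
                  \<le> D * (log 2 (real n))\<^sup>2))"
proof -
  obtain c0 where c0: "\<And>m a b xs A. a < b \<Longrightarrow> length xs = m \<Longrightarrow> set xs \<subseteq> {a..b} \<Longrightarrow>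
      (\<And>t. t < m \<Longrightarrow> A (adv m a b (take (Suc t) xs)) = xs ! t) \<Longrightarrow>
      array_cost m A \<le> c0 * sqrt (real m) * (b - a)"
    using assms(2) unfolding adversarial_cost_sqrt_def by blast
  \<comment> \<open>A nonnegative constant makes the cost bound monotone in the bucket size.\<close>
  define c where "c = max c0 0"
  have c: "array_cost m A \<le> c * sqrt (real m) * (b - a)"
    if "a < b" "length xs = m" "set xs \<subseteq> {a..b}"
      "\<And>t. t < m \<Longrightarrow> A (adv m a b (take (Suc t) xs)) = xs ! t" for m a b xs and A :: "nat \<Rightarrow> real"
  proof -
    have "c0 * (sqrt (real m) * (b - a)) \<le> c * (sqrt (real m) * (b - a))"
      using that(1) by (intro mult_right_mono) (auto simp: c_def)
    then show ?thesis using c0[OF that] by (simp add: mult.assoc)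
  qed
  have ev1: "\<forall>\<^sub>F n :: nat in sequentially. log 2 (real n) \<ge> 10" by real_asymp
  have ev2: "\<forall>\<^sub>F n :: nat in sequentially. real n \<ge> 100 * (log 2 (real n))\<^sup>2" by real_asymp
  \<comment> \<open>The union bound has \<open>(n + 1)^2\<close> windows for at most
    \<open>(n + 1)^2\<close> pairs of resolution and bucket. The exponential is \<open>n\<close> to
    a power of order \<open>- log n\<close>, which beats every polynomial.\<close>
  have ev3: "\<forall>\<^sub>F n :: nat in sequentially.
      2 * ((real n + 1)\<^sup>2 * (real n + 1)\<^sup>2) * exp (- (log 2 (real n))\<^sup>2 / 4800) \<le> 1 / real n"
    by real_asymp
  obtain N where N: "\<And>n. n \<ge> N \<Longrightarrow> log 2 (real n) \<ge> 10 \<and> real n \<ge> 100 * (log 2 (real n))\<^sup>2 \<and>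
      2 * ((real n + 1)\<^sup>2 * (real n + 1)\<^sup>2) * exp (- (log 2 (real n))\<^sup>2 / 4800) \<le> 1 / real n"
    using eventually_conj[OF ev1 eventually_conj[OF ev2 ev3]] unfolding eventually_sequentially by blast
  \<comment> \<open>\<open>20 * c\<close> comes from at most \<open>2 * L\<close> rows at
    \<open>10 * c * L\<close> each, 30 from the unlisted cells of \<open>A\<^sub>k\<close>, and the
    remaining 2 absorbs \<open>6 * L + 100\<close>.\<close>
  show ?thesis
  proof (rule exI[of _ "20 * c + 32"], rule exI[of _ N], intro allI impI)
    fix n split spill
    assume n: "n \<ge> N" and split: "balanced_split split" and spill: "chooses_member spill"
    define L where "L = log 2 (real n)"
    define V where "V = L\<^sup>2"
    have L: "L \<ge> 10" and nV: "real n \<ge> 100 * V"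
      and prob: "2 * ((real n + 1)\<^sup>2 * (real n + 1)\<^sup>2) * exp (- V / 4800) \<le> 1 / real n"
      using N[OF n] by (simp_all add: L_def V_def)
    note par = scale_parameters[of n, folded L_def, folded V_def, OF L nV]
    have LL: "10 * L \<le> V" using L by (simp add: V_def power2_eq_square mult_right_mono)
    then have V: "V \<ge> 100" using L by linarith
    \<comment> \<open>Level 0 is included, for the fictitious predecessor of
      \<open>A\<^sub>1\<close>.\<close>
    define P where "P = (SIGMA m:num_buckets n ` {..num_subs n}. {1..m})"
    have P: "finite P" "\<And>m j. (m, j) \<in> P \<Longrightarrow> j \<in> {1..m}"
      by (auto simp: P_def)
    have "P \<subseteq> {..n} \<times> {..n}"
      using par(9) by (auto simp: P_def intro: order_trans)
    then have "card P \<le> card ({..n} \<times> {..n})" by (intro card_mono) auto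
    then have "card P \<le> (n + 1)\<^sup>2" by (simp add: card_cartesian_product power2_eq_square)
    then have "real ((n + 1)\<^sup>2 * card P) \<le> real ((n + 1)\<^sup>2 * (n + 1)\<^sup>2)"
      by (intro of_nat_mono mult_left_mono) auto
    also have "\<dots> = (real n + 1)\<^sup>2 * (real n + 1)\<^sup>2" by (simp add: add.commute)
    finally have "2 * real ((n + 1)\<^sup>2 * card P) * exp (- V / 4800) \<le> 1 / real n"
      using prob by (smt (verit) mult_right_mono exp_ge_zero)
    moreover obtain E where E: "E \<in> sets (iid_uniform n)"
      "measure (iid_uniform n) E \<ge> 1 - 2 * real ((n + 1)\<^sup>2 * card P) * exp (- V / 4800)"
      "\<And>x. x \<in> E \<Longrightarrow> (\<forall>r<n. 0 < x r \<and> x r \<le> 1) \<and>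
        (\<forall>m j a b. (m, j) \<in> P \<longrightarrow> a \<le> b \<longrightarrow> b \<le> n \<longrightarrow> real (b - a) \<le> 3 * V * real m \<longrightarrow>
          \<bar>real (window_count (map x [0..<n]) m a b j) - real (b - a) / real m\<bar> \<le> V / 20)"
      using uniform_window_concentration[OF P, of n V] by blast
    ultimately have "measure (iid_uniform n) E \<ge> 1 - 1 / real n" by linarith
    moreover have "phased_sorting.total_cost n adv split spill (map x [0..<n]) \<le> (20 * c + 32) * V"
      if x: "x \<in> E" for x
    proof -
      interpret phased_run_cost n adv split spill "map x [0..<n]" V c
      proof unfold_locales
        show "set (map x [0..<n]) \<subseteq> {0<..1}" using E(3)[OF x] by auto
        show "\<bar>real (window_count (map x [0..<n]) (num_buckets n i) a b j)
            - real (b - a) / num_buckets n i\<bar> \<le> V / 20"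
          if "i \<le> num_subs n" "j \<in> {1..num_buckets n i}" "a \<le> b" "b \<le> n"
            "real (b - a) \<le> 3 * V * num_buckets n i" for i j a b
        proof -
          have "(num_buckets n i, j) \<in> P" using that by (auto simp: P_def)
          then show ?thesis using E(3)[OF x] that by blast
        qed
      qed (use assms(1) split spill V par c in \<open>auto simp: c_def\<close>)
      have "sqrt V = L" using L by (simp add: V_def)
      then have "total_cost (map x [0..<n]) \<le> real (Suc k) * (10 * c * L + 3) + 30 * V + 100"
        using total_cost_bound by simp
      also have "\<dots> \<le> 2 * L * (10 * c * L + 3) + 30 * V + 100"
      proof -
        have "real (Suc k) \<le> 2 * L" using par(3) L by simp
        then show ?thesis using c_nonneg L by (simp add: mult_right_mono)
      qed
      also have "\<dots> = 20 * c * V + 6 * L + 30 * V + 100"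
        by (simp add: V_def power2_eq_square algebra_simps)
      also have "\<dots> \<le> (20 * c + 32) * V" using LL V by (simp add: algebra_simps)
      finally show ?thesis .
    qed
    ultimately show "\<exists>E \<in> sets (iid_uniform n).
      measure (iid_uniform n) E \<ge> 1 - 1 / real n \<and>
      (\<forall>x \<in> E. phased_sorting.total_cost n adv split spill (map x [0..<n])
                  \<le> (20 * c + 32) * (log 2 (real n))\<^sup>2)"
      using E(1) unfolding V_def L_def by blast
  qed
qed

end
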